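(* Let $K$ be a field. For any locally finite partially ordered set $X$, the map $\theta:KX\rightarrow FIA(X)^0$ defined by $\theta(c)(c^* )=c^*(c)$ for $c\in KX$, $c^*\in FIA(X)$, is an isomorphism of coalgebras.
   Context: A partially ordered set $X$ is locally finite if $\{z\mid x\le z\le y\}$ is finite for all $x\le y$ in $X$. The incidence coalgebra $KX$ is the $K$-vector space with basis $\{e_{x,y}\mid x,y\in X,\ x\le y\}$, comultiplication $\Delta(e_{x,y})=\sum_{x\le z\le y}e_{x,z}\otimes e_{z,y}$ and counit $\epsilon(e_{x,y})=\delta_{x,y}$. The incidence algebra $IA(X)$ is the space of all functions $f:\{(x,y)\mid x,y\in X,\ x\le y\}\to K$ with product $(fg)(x,y)=\sum_{x\le z\le y}f(x,z)g(z,y)$; it is identified with the dual algebra $(KX)^*$ via $f(e_{x,y})=f(x,y)$. $FIA(X)$ is the subalgebra (not necessarily with identity) of $IA(X)$ of all functions with finite support, i.e. the span of the elements $E_{x,y}$ ($x\le y$), where $E_{x,y}(e_{u,v})=\delta_{x,u}\delta_{y,v}$; the elements $E_{x,x}$, $x\in X$, form a complete system of orthogonal idempotents of $FIA(X)$. $FIA(X)^0=\{f\in FIA(X)^*\mid \mathrm{Ker}(f)$ contains a two-sided ideal of $FIA(X)$ of finite codimension$\}$, which is a coalgebra with $\Delta(f)=\sum_i u_i\otimes v_i$ (with $u_i,v_i\in FIA(X)^0$) if and only if $f(ab)=\sum_i u_i(a)v_i(b)$ for all $a,b\in FIA(X)$, and counit $\varepsilon(f)=\sum_{x\in X}f(E_{x,x})$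 (only finitely many terms are nonzero). For $c\in KX$, $\theta(c)$ does lie in $FIA(X)^0$. *)

theory Defs
  imports "Jordan_Normal_Form.Missing_VectorSpace" "HOL-Algebra.AbelCoset"
begin

text \<open>
  Vector spaces over \<open>K\<close> are records of type \<^typ>\<open>('k, 'v) module\<close>.  A plain vector space
  makes no use of the fields \<open>mult\<close> and \<open>one\<close>; a (not necessarily unital) algebra uses
  \<open>mult\<close> but not \<open>one\<close>.
\<close>

section \<open>Vector spaces\<close>

definition self_space :: "('k, 'm) ring_scheme \<Rightarrow> ('k, 'k) module" where
  "self_space K = \<lparr>carrier = carrier K, mult = mult K, one = one K,
     zero = zero K, add = add K, smult = mult K\<rparr>"

definition free_space :: "('k, 'm) ring_scheme \<Rightarrow> 's set \<Rightarrow> ('k, 's \<Rightarrow> 'k) module" where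
  "free_space K S = (ring.func_space K S)
     \<lparr>carrier := {f \<in> S \<rightarrow>\<^sub>E carrier K. finite {s \<in> S. f s \<noteq> \<zero>\<^bsub>K\<^esub>}}\<rparr>"

definition basis_vec :: "('k, 'm) ring_scheme \<Rightarrow> 's set \<Rightarrow> 's \<Rightarrow> 's \<Rightarrow> 'k" where
  "basis_vec K S s = (\<lambda>t\<in>S. if t = s then \<one>\<^bsub>K\<^esub> else \<zero>\<^bsub>K\<^esub>)"

text \<open>The linear map from the free space on \<open>S\<close> to \<open>U\<close> sending the basis vector of \<open>s\<close> to \<open>g s\<close>.\<close>

definition lin_ext ::
  "('k, 'm) ring_scheme \<Rightarrow> 's set \<Rightarrow> ('k, 'u) module \<Rightarrow> ('s \<Rightarrow> 'u) \<Rightarrow> ('s \<Rightarrow> 'k) \<Rightarrow> 'u" where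
  "lin_ext K S U g c = (\<Oplus>\<^bsub>U\<^esub> s \<in> {s \<in> S. c s \<noteq> \<zero>\<^bsub>K\<^esub>}. c s \<odot>\<^bsub>U\<^esub> g s)"

text \<open>Linear forms are made extensional, so that equality of forms is equality of functions.\<close>

definition dual_space :: "('k, 'm) ring_scheme \<Rightarrow> ('k, 'v) module \<Rightarrow> ('k, 'v \<Rightarrow> 'k) module" where
  "dual_space K V = (ring.func_space K (carrier V))
     \<lparr>carrier := module_hom K V (self_space K) \<inter> extensional (carrier V)\<rparr>"

definition quot_space :: "('k, 'v) module \<Rightarrow> 'v set \<Rightarrow> ('k, 'v set) module" where
  "quot_space V W = \<lparr>carrier = a_rcosets\<^bsub>V\<^esub> W, mult = (\<lambda>A B. W), one = W,
     zero = W, add = (\<lambda>A B. A <+>\<^bsub>V\<^esub> B), smult = (\<lambda>c A. \<Union>v\<in>A. W +>\<^bsub>V\<^esub> (c \<odot>\<^bsub>V\<^esub> v))\<rparr>"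


section \<open>Tensor products\<close>

definition tensor_relators ::
  "('k, 'm) ring_scheme \<Rightarrow> ('k, 'v) module \<Rightarrow> ('k, 'w) module \<Rightarrow> ('v \<times> 'w \<Rightarrow> 'k) set" where
  "tensor_relators K V W =
    (let F = free_space K (carrier V \<times> carrier W);
         d = (\<lambda>v w. basis_vec K (carrier V \<times> carrier W) (v, w))
     in {d (v \<oplus>\<^bsub>V\<^esub> v') w \<ominus>\<^bsub>F\<^esub> (d v w \<oplus>\<^bsub>F\<^esub> d v' w) | v v' w.
           v \<in> carrier V \<and> v' \<in> carrier V \<and> w \<in> carrier W}
      \<union> {d v (w \<oplus>\<^bsub>W\<^esub> w') \<ominus>\<^bsub>F\<^esub> (d v w \<oplus>\<^bsub>F\<^esub> d v w') | v w w'.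
           v \<in> carrier V \<and> w \<in> carrier W \<and> w' \<in> carrier W}
      \<union> {d (a \<odot>\<^bsub>V\<^esub> v) w \<ominus>\<^bsub>F\<^esub> (a \<odot>\<^bsub>F\<^esub> d v w) | a v w.
           a \<in> carrier K \<and> v \<in> carrier V \<and> w \<in> carrier W}
      \<union> {d v (a \<odot>\<^bsub>W\<^esub> w) \<ominus>\<^bsub>F\<^esub> (a \<odot>\<^bsub>F\<^esub> d v w) | a v w.
           a \<in> carrier K \<and> v \<in> carrier V \<and> w \<in> carrier W})"

definition tensor_kernel ::
  "('k, 'm) ring_scheme \<Rightarrow> ('k, 'v) module \<Rightarrow> ('k, 'w) module \<Rightarrow> ('v \<times> 'w \<Rightarrow> 'k) set" where
  "tensor_kernel K V W =
     LinearCombinations.module.span K (free_space K (carrier V \<times> carrier W)) (tensor_relators K V W)"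

definition tensor_space ::
  "('k, 'm) ring_scheme \<Rightarrow> ('k, 'v) module \<Rightarrow> ('k, 'w) module \<Rightarrow> ('k, ('v \<times> 'w \<Rightarrow> 'k) set) module"
  where
  "tensor_space K V W =
     quot_space (free_space K (carrier V \<times> carrier W)) (tensor_kernel K V W)"

definition tensor ::
  "('k, 'm) ring_scheme \<Rightarrow> ('k, 'v) module \<Rightarrow> ('k, 'w) module \<Rightarrow> 'v \<Rightarrow> 'w \<Rightarrow> ('v \<times> 'w \<Rightarrow> 'k) set"
  where
  "tensor K V W v w =
     tensor_kernel K V W +>\<^bsub>free_space K (carrier V \<times> carrier W)\<^esub>
       basis_vec K (carrier V \<times> carrier W) (v, w)"

text \<open>The linear map on the tensor product induced by a map \<open>b\<close>; meaningful when \<open>b\<close> is bilinear.\<close>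

definition tensor_lift ::
  "('k, 'm) ring_scheme \<Rightarrow> ('k, 'v) module \<Rightarrow> ('k, 'w) module \<Rightarrow> ('k, 'u) module \<Rightarrow>
     ('v \<Rightarrow> 'w \<Rightarrow> 'u) \<Rightarrow> ('v \<times> 'w \<Rightarrow> 'k) set \<Rightarrow> 'u" where
  "tensor_lift K V W U b =
     (THE h. h \<in> module_hom K (tensor_space K V W) U \<inter> extensional (carrier (tensor_space K V W)) \<and>
             (\<forall>v\<in>carrier V. \<forall>w\<in>carrier W. h (tensor K V W v w) = b v w))"

definition tensor_map ::
  "('k, 'm) ring_scheme \<Rightarrow> ('k, 'v) module \<Rightarrow> ('k, 'w) module \<Rightarrow> ('k, 'v2) module \<Rightarrow> ('k, 'w2) module
     \<Rightarrow> ('v \<Rightarrow> 'v2) \<Rightarrow> ('w \<Rightarrow> 'w2) \<Rightarrow> ('v \<times> 'w \<Rightarrow> 'k) set \<Rightarrow> ('v2 \<times> 'w2 \<Rightarrow> 'k) set" where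
  "tensor_map K V W V' W' f g =
     tensor_lift K V W (tensor_space K V' W') (\<lambda>v w. tensor K V' W' (f v) (g w))"

definition tensor_assoc ::
  "('k, 'm) ring_scheme \<Rightarrow> ('k, 'u) module \<Rightarrow> ('k, 'v) module \<Rightarrow> ('k, 'w) module \<Rightarrow>
     (('u \<times> 'v \<Rightarrow> 'k) set \<times> 'w \<Rightarrow> 'k) set \<Rightarrow> ('u \<times> ('v \<times> 'w \<Rightarrow> 'k) set \<Rightarrow> 'k) set" where
  "tensor_assoc K U V W =
     (let UVW = tensor_space K U (tensor_space K V W)
      in tensor_lift K (tensor_space K U V) W UVW
           (\<lambda>t w. tensor_lift K U V UVW
              (\<lambda>u v. tensor K U (tensor_space K V W) u (tensor K V W v w)) t))"


section \<open>Coalgebras\<close>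

locale coalgebra = vectorspace K C
  for K :: "('k, 'm) ring_scheme" and C :: "('k, 'c) module" +
  fixes \<Delta> :: "'c \<Rightarrow> ('c \<times> 'c \<Rightarrow> 'k) set" and \<epsilon> :: "'c \<Rightarrow> 'k"
  assumes comult_linear: "\<Delta> \<in> module_hom K C (tensor_space K C C)"
    and counit_linear: "\<epsilon> \<in> module_hom K C (self_space K)"
    and coassoc: "c \<in> carrier C \<Longrightarrow>
      tensor_assoc K C C C (tensor_map K C C (tensor_space K C C) C \<Delta> (\<lambda>x. x) (\<Delta> c)) =
      tensor_map K C C C (tensor_space K C C) (\<lambda>x. x) \<Delta> (\<Delta> c)"
    and counit_left: "c \<in> carrier C \<Longrightarrow> tensor_lift K C C C (\<lambda>a b. \<epsilon> a \<odot>\<^bsub>C\<^esub> b) (\<Delta> c) = c"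
    and counit_right: "c \<in> carrier C \<Longrightarrow> tensor_lift K C C C (\<lambda>a b. \<epsilon> b \<odot>\<^bsub>C\<^esub> a) (\<Delta> c) = c"

locale coalgebra_iso =
  dom: coalgebra K C \<Delta>\<^sub>C \<epsilon>\<^sub>C + cod: coalgebra K D \<Delta>\<^sub>D \<epsilon>\<^sub>D
  for K :: "('k, 'm) ring_scheme"
    and C :: "('k, 'c) module" and \<Delta>\<^sub>C and \<epsilon>\<^sub>C
    and D :: "('k, 'd) module" and \<Delta>\<^sub>D and \<epsilon>\<^sub>D +
  fixes \<phi> :: "'c \<Rightarrow> 'd"
  assumes linear: "\<phi> \<in> module_hom K C D"
    and bij: "bij_betw \<phi> (carrier C) (carrier D)"
    and comult: "c \<in> carrier C \<Longrightarrow> \<Delta>\<^sub>D (\<phi> c) = tensor_map K C C D D \<phi> \<phi> (\<Delta>\<^sub>C c)"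
    and counit: "c \<in> carrier C \<Longrightarrow> \<epsilon>\<^sub>D (\<phi> c) = \<epsilon>\<^sub>C c"


section \<open>The finite dual of an algebra\<close>

definition two_sided_ideal :: "('k, 'm) ring_scheme \<Rightarrow> ('k, 'a) module \<Rightarrow> 'a set \<Rightarrow> bool" where
  "two_sided_ideal K A I \<longleftrightarrow> subspace K I A \<and>
     (\<forall>a\<in>carrier A. \<forall>x\<in>I. a \<otimes>\<^bsub>A\<^esub> x \<in> I \<and> x \<otimes>\<^bsub>A\<^esub> a \<in> I)"

definition finite_dual :: "('k, 'm) ring_scheme \<Rightarrow> ('k, 'a) module \<Rightarrow> ('k, 'a \<Rightarrow> 'k) module" where
  "finite_dual K A = (dual_space K A)\<lparr>carrier := {f \<in> carrier (dual_space K A).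
     \<exists>I. two_sided_ideal K A I \<and> vectorspace.fin_dim K (quot_space A I) \<and>
         I \<subseteq> {a \<in> carrier A. f a = \<zero>\<^bsub>K\<^esub>}}\<rparr>"

definition finite_dual_comult ::
  "('k, 'm) ring_scheme \<Rightarrow> ('k, 'a) module \<Rightarrow> ('a \<Rightarrow> 'k) \<Rightarrow> (('a \<Rightarrow> 'k) \<times> ('a \<Rightarrow> 'k) \<Rightarrow> 'k) set" where
  "finite_dual_comult K A f =
    (let A0 = finite_dual K A in
     THE t. \<exists>(n::nat) u v. (\<forall>i<n. u i \<in> carrier A0 \<and> v i \<in> carrier A0) \<and>
       t = (\<Oplus>\<^bsub>tensor_space K A0 A0\<^esub> i \<in> {..<n}. tensor K A0 A0 (u i) (v i)) \<and>
       (\<forall>a\<in>carrier A. \<forall>b\<in>carrier A. f (a \<otimes>\<^bsub>A\<^esub> b) = (\<Oplus>\<^bsub>K\<^esub> i \<in> {..<n}. u i a \<otimes>\<^bsub>K\<^esub> v i b)))"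


section \<open>Incidence coalgebras and finitary incidence algebras\<close>

text \<open>
  A partially ordered set is given by an underlying set \<open>X\<close> and its order relation
  \<open>r \<subseteq> X \<times> X\<close>, so that \<open>r\<close> is also the set of all pairs \<open>(x, y)\<close> with \<open>x \<le> y\<close>.
\<close>

definition interval :: "('x \<times> 'x) set \<Rightarrow> 'x \<Rightarrow> 'x \<Rightarrow> 'x set" where
  "interval r x y = {z. (x, z) \<in> r \<and> (z, y) \<in> r}"

definition locally_finite_order :: "('x \<times> 'x) set \<Rightarrow> bool" where
  "locally_finite_order r \<longleftrightarrow> (\<forall>(x, y) \<in> r. finite (interval r x y))"

definition inc_coalg :: "('k, 'm) ring_scheme \<Rightarrow> ('x \<times> 'x) set \<Rightarrow> ('k, 'x \<times> 'x \<Rightarrow> 'k) module" where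
  "inc_coalg K r = free_space K r"

definition inc_comult ::
  "('k, 'm) ring_scheme \<Rightarrow> ('x \<times> 'x) set \<Rightarrow> ('x \<times> 'x \<Rightarrow> 'k) \<Rightarrow>
     (('x \<times> 'x \<Rightarrow> 'k) \<times> ('x \<times> 'x \<Rightarrow> 'k) \<Rightarrow> 'k) set" where
  "inc_comult K r =
    (let C = inc_coalg K r in
     lin_ext K r (tensor_space K C C)
       (\<lambda>(x, y). \<Oplus>\<^bsub>tensor_space K C C\<^esub> z \<in> interval r x y.
          tensor K C C (basis_vec K r (x, z)) (basis_vec K r (z, y))))"

definition inc_counit :: "('k, 'm) ring_scheme \<Rightarrow> ('x \<times> 'x) set \<Rightarrow> ('x \<times> 'x \<Rightarrow> 'k) \<Rightarrow> 'k" where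
  "inc_counit K r =
     lin_ext K r (self_space K) (\<lambda>(x, y). if x = y then \<one>\<^bsub>K\<^esub> else \<zero>\<^bsub>K\<^esub>)"

definition inc_alg :: "('k, 'm) ring_scheme \<Rightarrow> ('x \<times> 'x) set \<Rightarrow> ('k, 'x \<times> 'x \<Rightarrow> 'k) module" where
  "inc_alg K r = (ring.func_space K r)
     \<lparr>mult := (\<lambda>f g. \<lambda>(x, y)\<in>r. \<Oplus>\<^bsub>K\<^esub> z \<in> interval r x y. f (x, z) \<otimes>\<^bsub>K\<^esub> g (z, y)),
      one := (\<lambda>(x, y)\<in>r. if x = y then \<one>\<^bsub>K\<^esub> else \<zero>\<^bsub>K\<^esub>)\<rparr>"

text \<open>
  The field \<open>one\<close> inherited here need not lie in the carrier; it is not used.  The matrix units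
  \<open>E\<^sub>x\<^sub>y\<close> of this algebra are the functions \<open>basis_vec K r (x, y)\<close>.
\<close>

definition fin_inc_alg :: "('k, 'm) ring_scheme \<Rightarrow> ('x \<times> 'x) set \<Rightarrow> ('k, 'x \<times> 'x \<Rightarrow> 'k) module" where
  "fin_inc_alg K r = (inc_alg K r)
     \<lparr>carrier := {f \<in> carrier (inc_alg K r). finite {p \<in> r. f p \<noteq> \<zero>\<^bsub>K\<^esub>}}\<rparr>"

text \<open>
  \<open>\<epsilon>(f) = \<Sum>\<^sub>x f(E\<^sub>x\<^sub>x)\<close>.  The sum is restricted to the nonzero terms because \<^const>\<open>finsum\<close> over an
  infinite index set carries no information.
\<close>

definition fin_inc_counit ::
  "('k, 'm) ring_scheme \<Rightarrow> 'x set \<Rightarrow> ('x \<times> 'x) set \<Rightarrow> (('x \<times> 'x \<Rightarrow> 'k) \<Rightarrow> 'k) \<Rightarrow> 'k" where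
  "fin_inc_counit K X r f =
     (\<Oplus>\<^bsub>K\<^esub> x \<in> {x \<in> X. f (basis_vec K r (x, x)) \<noteq> \<zero>\<^bsub>K\<^esub>}. f (basis_vec K r (x, x)))"

text \<open>The value \<open>c*(c)\<close> under the identification \<open>f(e\<^sub>x\<^sub>y) = f(x, y)\<close> of \<open>IA(X)\<close> with the dual of \<open>KX\<close>.\<close>

definition inc_eval ::
  "('k, 'm) ring_scheme \<Rightarrow> ('x \<times> 'x) set \<Rightarrow> ('x \<times> 'x \<Rightarrow> 'k) \<Rightarrow> ('x \<times> 'x \<Rightarrow> 'k) \<Rightarrow> 'k" where
  "inc_eval K r f c = lin_ext K r (self_space K) f c"

definition theta ::
  "('k, 'm) ring_scheme \<Rightarrow> ('x \<times> 'x) set \<Rightarrow> ('x \<times> 'x \<Rightarrow> 'k) \<Rightarrow> ('x \<times> 'x \<Rightarrow> 'k) \<Rightarrow> 'k" where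
  "theta K r c = (\<lambda>f\<in>carrier (fin_inc_alg K r). inc_eval K r f c)"

end

theory Submission
  imports Defs
begin

text \<open>
  Write \<open>A\<close> for \<open>FIA(X)\<close>.  If \<open>f \<in> A\<^sup>0\<close> vanishes on an ideal \<open>I\<close> of finite codimension, then \<open>E\<^sub>x\<^sub>x a E\<^sub>y\<^sub>y\<close>
  is \<open>a(x, y) E\<^sub>x\<^sub>y\<close>, so the matrix units outside \<open>I\<close> are linearly independent modulo \<open>I\<close>; hence
  there are only finitely many of them, \<open>f\<close> is nonzero on finitely many matrix units, and
  \<open>f = \<theta>(\<Sum> f(E\<^sub>x\<^sub>y) e\<^sub>x\<^sub>y)\<close>.  Conversely, \<open>\<theta>(c)\<close> vanishes on the ideal of all \<open>a\<close> that are zero on the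
  finitely many pairs lying inside an interval from the support of \<open>c\<close>.  An element \<open>t\<close> of
  \<open>A\<^sup>0 \<otimes> A\<^sup>0\<close> is determined by the values \<open>t(a, b)\<close>, since it is a combination of the tensors
  \<open>\<theta>(e\<^sub>p) \<otimes> \<theta>(e\<^sub>q)\<close> and its coefficients are the values at \<open>(E\<^sub>p, E\<^sub>q)\<close>; so
  \<open>\<Delta>(\<theta>(e\<^sub>x\<^sub>y)) = \<Sum>\<^sub>z \<theta>(e\<^sub>x\<^sub>z) \<otimes> \<theta>(e\<^sub>z\<^sub>y)\<close> is just the formula for the product of \<open>A\<close>.
\<close>

section \<open>Linear maps and free spaces\<close>

text \<open>The locale \<open>coalgebra_iso\<close> demands that both sides be coalgebras, and on
  the side of \<open>A\<^sup>0\<close> little of this is visible: its comultiplication is a definite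
  description, so existence, uniqueness and linearity all have to be earned, and closure under
  addition would call for intersections of ideals. The way around is transport along \<theta>. Once
  \<theta> is a linear map into the full dual whose range is \<open>A\<^sup>0\<close>, the latter is
  a module as an image; and the identity \<Delta>(\<theta>(c)) = (\<theta> \<otimes>
  \<theta>)(\<Delta>(c)) not only compares the two structures but also yields linearity of the
  comultiplication of \<open>A\<^sup>0\<close>. The coalgebra axioms are verified a single time, for
  any space spanned by elements that comultiply like the \<open>e\<^sub>x\<^sub>y\<close>, and this
  is applied to both sides. Since the tensor product is given as a bare quotient of a free space by
  a span, its universal property, and from it tensor maps and the associativity map, must be derived
  from the relators.\<close>

lemma module_homI:
  assumes "\<And>v. v \<in> carrier V \<Longrightarrow> h v \<in> carrier W"
    and "\<And>v w. \<lbrakk>v \<in> carrier V; w \<in> carrier V\<rbrakk> \<Longrightarrow> h (v \<oplus>\<^bsub>V\<^esub> w) = h v \<oplus>\<^bsub>W\<^esub> h w"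
    and "\<And>a v. \<lbrakk>a \<in> carrier R; v \<in> carrier V\<rbrakk> \<Longrightarrow> h (a \<odot>\<^bsub>V\<^esub> v) = a \<odot>\<^bsub>W\<^esub> h v"
  shows "h \<in> module_hom R V W"
  using assms by (auto simp: module_hom_def)

lemma module_hom_in_carrier: "\<lbrakk>h \<in> module_hom R V W; v \<in> carrier V\<rbrakk> \<Longrightarrow> h v \<in> carrier W"
  by (auto simp: module_hom_def)

lemma module_hom_zero:
  assumes "module R V" "module R W" "h \<in> module_hom R V W"
  shows "h \<zero>\<^bsub>V\<^esub> = \<zero>\<^bsub>W\<^esub>"
proof -
  interpret mod_hom R V W h
    using assms by (simp add: mod_hom_def mod_hom_axioms_def)
  show ?thesis by simp
qed

lemma module_hom_minus:
  assumes "module R V" "module R W" "h \<in> module_hom R V W" "v \<in> carrier V" "w \<in> carrier V"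
  shows "h (v \<ominus>\<^bsub>V\<^esub> w) = h v \<ominus>\<^bsub>W\<^esub> h w"
proof -
  interpret mod_hom R V W h
    using assms by (simp add: mod_hom_def mod_hom_axioms_def)
  show ?thesis using assms(4,5) by simp
qed

lemma module_hom_finsum:
  assumes "module R V" "module R W" "h \<in> module_hom R V W" "g \<in> A \<rightarrow> carrier V"
  shows "h (\<Oplus>\<^bsub>V\<^esub>i\<in>A. g i) = (\<Oplus>\<^bsub>W\<^esub>i\<in>A. h (g i))"
proof -
  interpret V: module R V by fact
  interpret W: module R W by fact
  show ?thesis
    using assms(4)
  proof (induction A rule: infinite_finite_induct)
    \<comment> \<open>Over an infinite index set \<open>finsum\<close> has the default value zero,
      on both sides, and a linear map preserves zero.\<close>
    case (infinite A)
    then show ?case using module_hom_zero[OF assms(1-3)] by simp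
  next
    case empty
    then show ?case using module_hom_zero[OF assms(1-3)] by simp
  next
    case (insert x F)
    then have "g \<in> F \<rightarrow> carrier V" "g x \<in> carrier V" by auto
    moreover have "(\<lambda>i. h (g i)) \<in> F \<rightarrow> carrier W"
      using insert.prems module_hom_in_carrier[OF assms(3)] by fastforce
    ultimately show ?case
      using insert module_hom_add[OF assms(3)] module_hom_in_carrier[OF assms(3)] by simp
  qed
qed

lemma module_hom_comp:
  "\<lbrakk>h \<in> module_hom R V W; k \<in> module_hom R U V\<rbrakk> \<Longrightarrow> (\<lambda>u. h (k u)) \<in> module_hom R U W"
  unfolding module_hom_def by auto (auto simp: Pi_iff)

lemma module_hom_id: "(\<lambda>v. v) \<in> module_hom R V V"
  by (auto simp: module_hom_def)

lemma module_hom_sum: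
  assumes "module R W" "h \<in> module_hom R V W" "k \<in> module_hom R V W"
  shows "(\<lambda>v. h v \<oplus>\<^bsub>W\<^esub> k v) \<in> module_hom R V W"
proof -
  interpret W: module R W by fact
  show ?thesis
    using assms(2,3)
    by (intro module_homI)
      (auto simp: module_hom_in_carrier module_hom_add module_hom_smult W.smult_r_distr W.M.a_ac)
qed

lemma module_hom_scale:
  assumes "module R W" "h \<in> module_hom R V W" "a \<in> carrier R"
  shows "(\<lambda>v. a \<odot>\<^bsub>W\<^esub> h v) \<in> module_hom R V W"
proof -
  interpret W: module R W by fact
  show ?thesis
    using assms(2,3)
    by (intro module_homI)
      (auto simp: module_hom_in_carrier module_hom_add module_hom_smult W.smult_r_distr
        W.R.m_comm simp flip: W.smult_assoc1)
qed

lemma module_hom_smult_right: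
  assumes "module R W" "w \<in> carrier W" "h \<in> module_hom R V (self_space R)"
  shows "(\<lambda>v. h v \<odot>\<^bsub>W\<^esub> w) \<in> module_hom R V W"
proof -
  interpret W: module R W by fact
  show ?thesis
    using assms(2,3)
    by (intro module_homI)
      (auto simp: module_hom_def self_space_def Pi_iff W.smult_l_distr W.smult_assoc1)
qed

lemma vectorspaceI: "\<lbrakk>field R; module R V\<rbrakk> \<Longrightarrow> vectorspace R V"
  by (simp add: vectorspace_def)

lemma self_space_simps:
  "carrier (self_space R) = carrier R" "zero (self_space R) = zero R" "add (self_space R) = add R"
  "smult (self_space R) = mult R" "finsum (self_space R) = finsum R"
  by (auto simp: self_space_def finsum_def finprod_def fun_eq_iff)

context cring
begin

lemma self_space_module: "module R (self_space R)"
proof (rule module.intro)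
  have "abelian_monoid (self_space R)"
    by (rule abelian_monoidI) (auto simp: self_space_simps a_ac)
  moreover have "abelian_group (self_space R)"
    by (rule abelian_groupI) (auto simp: self_space_simps a_ac intro: l_neg)
  ultimately show "abelian_group (self_space R)" by simp
qed (auto simp: module_axioms_def self_space_simps l_distr r_distr m_assoc is_cring)


section \<open>Free spaces, their basis vectors and linear extension\<close>

lemma free_space_simps:
  "carrier (free_space R S) = {f \<in> S \<rightarrow>\<^sub>E carrier R. finite {s \<in> S. f s \<noteq> \<zero>}}"
  "zero (free_space R S) = (\<lambda>s\<in>S. \<zero>)"
  "add (free_space R S) = (\<lambda>f g. \<lambda>s\<in>S. f s \<oplus> g s)"
  "smult (free_space R S) = (\<lambda>c f. \<lambda>s\<in>S. c \<otimes> f s)"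
  by (auto simp: free_space_def func_space_def)

lemma free_space_module: "module R (free_space R S)"
proof -
  interpret F: module R "func_space S" by (rule func_space_is_module)
  have "submodule R {f \<in> S \<rightarrow>\<^sub>E carrier R. finite {s \<in> S. f s \<noteq> \<zero>}} (func_space S)"
  proof (rule submodule.intro)
    fix f g
    assume f: "f \<in> {f \<in> S \<rightarrow>\<^sub>E carrier R. finite {s \<in> S. f s \<noteq> \<zero>}}"
      and g: "g \<in> {f \<in> S \<rightarrow>\<^sub>E carrier R. finite {s \<in> S. f s \<noteq> \<zero>}}"
    have "{s \<in> S. f s \<oplus> g s \<noteq> \<zero>} \<subseteq> {s \<in> S. f s \<noteq> \<zero>} \<union> {s \<in> S. g s \<noteq> \<zero>}"
      by auto
    then have "finite {s \<in> S. f s \<oplus> g s \<noteq> \<zero>}"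
      using f g by (auto intro: finite_subset)
    then show "f \<oplus>\<^bsub>func_space S\<^esub> g \<in> {f \<in> S \<rightarrow>\<^sub>E carrier R. finite {s \<in> S. f s \<noteq> \<zero>}}"
      using f g by (auto simp: func_space_def PiE_mem cong: conj_cong)
  next
    fix c f
    assume c: "c \<in> carrier R" and f: "f \<in> {f \<in> S \<rightarrow>\<^sub>E carrier R. finite {s \<in> S. f s \<noteq> \<zero>}}"
    have "{s \<in> S. c \<otimes> f s \<noteq> \<zero>} \<subseteq> {s \<in> S. f s \<noteq> \<zero>}"
      using c by auto
    then have "finite {s \<in> S. c \<otimes> f s \<noteq> \<zero>}"
      using f by (auto intro: finite_subset)
    then show "c \<odot>\<^bsub>func_space S\<^esub> f \<in> {f \<in> S \<rightarrow>\<^sub>E carrier R. finite {s \<in> S. f s \<noteq> \<zero>}}"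
      using c f by (auto simp: func_space_def PiE_mem cong: conj_cong)
  qed (auto simp: func_space_def cong: conj_cong intro: func_space_is_module[unfolded func_space_def])
  from F.submodule_is_module[OF this] show ?thesis
    by (simp add: free_space_def)
qed

lemma basis_vec_closed:
  assumes "s \<in> S"
  shows "basis_vec R S s \<in> carrier (free_space R S)"
proof -
  have "{t \<in> S. basis_vec R S s t \<noteq> \<zero>} \<subseteq> {s}"
    by (auto simp: basis_vec_def split: if_splits)
  then have "finite {t \<in> S. basis_vec R S s t \<noteq> \<zero>}"
    by (rule finite_subset) simp
  then show ?thesis
    by (auto simp: free_space_simps basis_vec_def cong: conj_cong)
qed

text \<open>Finiteness of the support turns this into an induction over a finite set. The set is
  only required to contain the support, so that an index with coefficient zero does no harm.\<close>

lemma free_space_induct [consumes 1, case_names zero add]: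
  assumes "c \<in> carrier (free_space R S)"
    and "P \<zero>\<^bsub>free_space R S\<^esub>"
    and step: "\<And>a s c. \<lbrakk>a \<in> carrier R; s \<in> S; c \<in> carrier (free_space R S); P c\<rbrakk> \<Longrightarrow>
      P (a \<odot>\<^bsub>free_space R S\<^esub> basis_vec R S s \<oplus>\<^bsub>free_space R S\<^esub> c)"
  shows "P c"
proof -
  have "P c" if "finite A" "{s \<in> S. c s \<noteq> \<zero>} \<subseteq> A" "c \<in> carrier (free_space R S)" for A c
    using that
  proof (induction A arbitrary: c rule: finite_induct)
    case empty
    then have "c = \<zero>\<^bsub>free_space R S\<^esub>"
      by (force simp: free_space_simps PiE_iff extensional_def fun_eq_iff)
    then show ?case using assms(2) by simp
  next
    case (insert s A)
    show ?case
    proof (cases "s \<in> S")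
      case False
      then show ?thesis using insert by auto
    next
      case True
      \<comment> \<open>Erasing the coordinate at \<open>s\<close> leaves a vector supported in the
        smaller set, and \<open>c\<close> is recovered by adding back \<open>c s\<close> times the
        basis vector of \<open>s\<close>.\<close>
      define d where "d = c(s := \<zero>)"
      have sub: "{t \<in> S. d t \<noteq> \<zero>} \<subseteq> {t \<in> S. c t \<noteq> \<zero>}"
        by (auto simp: d_def)
      have cE: "c \<in> S \<rightarrow>\<^sub>E carrier R" "finite {t \<in> S. c t \<noteq> \<zero>}"
        using insert.prems by (auto simp: free_space_simps)
      have d: "d \<in> carrier (free_space R S)"
        using cE True finite_subset[OF sub]
        by (auto simp: free_space_simps d_def PiE_iff extensional_def)
      have "{t \<in> S. d t \<noteq> \<zero>} \<subseteq> A"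
        using insert.prems by (auto simp: d_def)
      then have "P d" using insert.IH d by blast
      moreover have "c = c s \<odot>\<^bsub>free_space R S\<^esub> basis_vec R S s \<oplus>\<^bsub>free_space R S\<^esub> d"
        using cE True
        by (auto simp: free_space_simps d_def basis_vec_def fun_eq_iff PiE_iff extensional_def)
      moreover have "c s \<in> carrier R" using cE True by auto
      ultimately show ?thesis using step[of "c s" s d] True d by metis
    qed
  qed
  then show ?thesis using assms(1) by (auto simp: free_space_simps)
qed

lemma free_space_hom_eqI:
  assumes "module R U" "h \<in> module_hom R (free_space R S) U" "k \<in> module_hom R (free_space R S) U"
    and "\<And>s. s \<in> S \<Longrightarrow> h (basis_vec R S s) = k (basis_vec R S s)"
    and "c \<in> carrier (free_space R S)"
  shows "h c = k c"
  using assms(5)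
proof (induction rule: free_space_induct)
  case zero
  then show ?case
    using assms(1-3) free_space_module by (metis module_hom_zero)
next
  case (add a s c)
  interpret F: module R "free_space R S" by (rule free_space_module)
  show ?case
    using add assms(2-4) by (simp add: module_hom_add module_hom_smult basis_vec_closed)
qed

text \<open>\<open>lin_ext\<close> sums over the support of its argument, which changes from vector
  to vector. Padding with zero terms gives several vectors a common index set, as needed for
  additivity.\<close>

lemma lin_ext_eq_finsum:
  assumes "module R U" "g \<in> S \<rightarrow> carrier U" "c \<in> carrier (free_space R S)"
    and "finite A" "A \<subseteq> S" "\<And>s. \<lbrakk>s \<in> S; s \<notin> A\<rbrakk> \<Longrightarrow> c s = \<zero>"
  shows "lin_ext R S U g c = (\<Oplus>\<^bsub>U\<^esub>s\<in>A. c s \<odot>\<^bsub>U\<^esub> g s)"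
proof -
  interpret U: module R U by fact
  have "c s \<odot>\<^bsub>U\<^esub> g s \<in> carrier U" if "s \<in> S" for s
    using that assms(2,3) by (auto simp: free_space_simps)
  then show ?thesis
    unfolding lin_ext_def using assms
    by (intro U.M.add.finprod_mono_neutral_cong_left) (auto simp: Pi_iff)
qed

lemma lin_ext_hom:
  assumes U: "module R U" and g: "g \<in> S \<rightarrow> carrier U"
  shows "lin_ext R S U g \<in> module_hom R (free_space R S) U"
proof -
  interpret U: module R U by fact
  interpret F: module R "free_space R S" by (rule free_space_module)
  have cl: "c s \<odot>\<^bsub>U\<^esub> g s \<in> carrier U" if "s \<in> S" "c \<in> carrier (free_space R S)" for s c
    using that g by (auto simp: free_space_simps)
  show ?thesis
  proof (rule module_homI)
    fix c assume c: "c \<in> carrier (free_space R S)"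
    then show "lin_ext R S U g c \<in> carrier U"
      unfolding lin_ext_def by (intro U.M.finsum_closed) (auto intro: cl)
  next
    fix c d assume c: "c \<in> carrier (free_space R S)" and d: "d \<in> carrier (free_space R S)"
    let ?A = "{s \<in> S. c s \<noteq> \<zero>} \<union> {s \<in> S. d s \<noteq> \<zero>}"
    have fin: "finite ?A" "?A \<subseteq> S" using c d by (auto simp: free_space_simps)
    have "lin_ext R S U g (c \<oplus>\<^bsub>free_space R S\<^esub> d) =
        (\<Oplus>\<^bsub>U\<^esub>s\<in>?A. (c \<oplus>\<^bsub>free_space R S\<^esub> d) s \<odot>\<^bsub>U\<^esub> g s)"
      using fin by (intro lin_ext_eq_finsum[OF U g F.M.a_closed[OF c d]]) (auto simp: free_space_simps)
    also have "\<dots> = (\<Oplus>\<^bsub>U\<^esub>s\<in>?A. c s \<odot>\<^bsub>U\<^esub> g s \<oplus>\<^bsub>U\<^esub> d s \<odot>\<^bsub>U\<^esub> g s)"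
      using g c d cl by (intro U.M.finsum_cong') (auto simp: free_space_simps intro!: U.smult_l_distr)
    also have "\<dots> = (\<Oplus>\<^bsub>U\<^esub>s\<in>?A. c s \<odot>\<^bsub>U\<^esub> g s) \<oplus>\<^bsub>U\<^esub> (\<Oplus>\<^bsub>U\<^esub>s\<in>?A. d s \<odot>\<^bsub>U\<^esub> g s)"
      using cl c d by (intro U.M.finsum_addf) auto
    also have "(\<Oplus>\<^bsub>U\<^esub>s\<in>?A. c s \<odot>\<^bsub>U\<^esub> g s) = lin_ext R S U g c"
      using fin by (intro lin_ext_eq_finsum[OF U g c, symmetric]) auto
    also have "(\<Oplus>\<^bsub>U\<^esub>s\<in>?A. d s \<odot>\<^bsub>U\<^esub> g s) = lin_ext R S U g d"
      using fin by (intro lin_ext_eq_finsum[OF U g d, symmetric]) auto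
    finally show "lin_ext R S U g (c \<oplus>\<^bsub>free_space R S\<^esub> d) =
      lin_ext R S U g c \<oplus>\<^bsub>U\<^esub> lin_ext R S U g d" .
  next
    fix a c assume a: "a \<in> carrier R" and c: "c \<in> carrier (free_space R S)"
    let ?A = "{s \<in> S. c s \<noteq> \<zero>}"
    have fin: "finite ?A" "?A \<subseteq> S" using c by (auto simp: free_space_simps)
    have "lin_ext R S U g (a \<odot>\<^bsub>free_space R S\<^esub> c) =
        (\<Oplus>\<^bsub>U\<^esub>s\<in>?A. (a \<odot>\<^bsub>free_space R S\<^esub> c) s \<odot>\<^bsub>U\<^esub> g s)"
      using fin a
      by (intro lin_ext_eq_finsum[OF U g F.smult_closed[OF a c]]) (auto simp: free_space_simps)
    also have "\<dots> = (\<Oplus>\<^bsub>U\<^esub>s\<in>?A. a \<odot>\<^bsub>U\<^esub> (c s \<odot>\<^bsub>U\<^esub> g s))"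
      using g c cl a by (intro U.M.finsum_cong') (auto simp: free_space_simps intro!: U.smult_assoc1)
    also have "\<dots> = a \<odot>\<^bsub>U\<^esub> lin_ext R S U g c"
      unfolding lin_ext_def using fin cl c a by (intro U.finsum_smult_ldistr[symmetric]) auto
    finally show "lin_ext R S U g (a \<odot>\<^bsub>free_space R S\<^esub> c) = a \<odot>\<^bsub>U\<^esub> lin_ext R S U g c" .
  qed
qed

lemma lin_ext_basis_vec:
  assumes U: "module R U" and g: "g \<in> S \<rightarrow> carrier U" and s: "s \<in> S"
  shows "lin_ext R S U g (basis_vec R S s) = g s"
proof -
  interpret U: module R U by fact
  have "lin_ext R S U g (basis_vec R S s) = (\<Oplus>\<^bsub>U\<^esub>t\<in>{s}. basis_vec R S s t \<odot>\<^bsub>U\<^esub> g t)"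
    using s by (intro lin_ext_eq_finsum[OF U g basis_vec_closed]) (auto simp: basis_vec_def)
  also have "\<dots> = g s"
    using g s by (auto simp: basis_vec_def Pi_iff)
  finally show ?thesis .
qed

lemma lin_ext_self: "c \<in> carrier (free_space R S) \<Longrightarrow> lin_ext R S (free_space R S) (basis_vec R S) c = c"
  by (rule free_space_hom_eqI[OF free_space_module lin_ext_hom module_hom_id])
    (auto simp: free_space_module lin_ext_basis_vec basis_vec_closed)

end

section \<open>Quotients and tensor products\<close>

context cring
begin

text \<open>Makes the library facts about additive cosets available for submodules. Negatives are
  obtained by scaling with \<open>\<ominus> \<one>\<close>.\<close>

lemma submodule_abelian_subgroup:
  assumes "submodule R W V"
  shows "abelian_subgroup W V"
proof -
  interpret W: submodule R W V by fact
  interpret V: module R V by (rule W.module)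
  have "subgroup W (add_monoid V)"
  proof (rule V.add.subgroupI)
    show "W \<noteq> {}" using W.zero_closed by blast
    fix w assume w: "w \<in> W"
    then have "(\<ominus> \<one>) \<odot>\<^bsub>V\<^esub> w \<in> W" by (intro W.smult_closed) auto
    moreover have "(\<ominus> \<one>) \<odot>\<^bsub>V\<^esub> w = \<ominus>\<^bsub>V\<^esub> w"
      using w W.subset by (intro V.smult_minus_1) auto
    ultimately show "\<ominus>\<^bsub>V\<^esub> w \<in> W" by simp
  qed (auto simp: W.subset)
  then show ?thesis
    by (intro abelian_subgroupI3 additive_subgroupI V.M.abelian_group_axioms)
qed

lemma coset_eq_iff:
  assumes "submodule R W V" "v \<in> carrier V" "w \<in> carrier V"
  shows "W +>\<^bsub>V\<^esub> v = W +>\<^bsub>V\<^esub> w \<longleftrightarrow> v \<ominus>\<^bsub>V\<^esub> w \<in> W"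
proof -
  interpret W: abelian_subgroup W V by (rule submodule_abelian_subgroup) fact
  show ?thesis
    using assms(2,3) W.a_rcos_module W.a_repr_independence' W.a_rcos_self
    by (metis a_minus_def)
qed

lemma quot_space_carrier:
  "carrier (quot_space V W) = (\<lambda>v. W +>\<^bsub>V\<^esub> v) ` carrier V"
  by (auto simp: quot_space_def A_RCOSETS_def')

lemma quot_space_zero:
  assumes "submodule R W V"
  shows "\<zero>\<^bsub>quot_space V W\<^esub> = W +>\<^bsub>V\<^esub> \<zero>\<^bsub>V\<^esub>"
proof -
  interpret W: submodule R W V by fact
  interpret V: module R V by (rule W.module)
  show ?thesis by (simp add: quot_space_def W.subset)
qed

lemma quot_space_add:
  assumes "submodule R W V" "v \<in> carrier V" "w \<in> carrier V"
  shows "(W +>\<^bsub>V\<^esub> v) \<oplus>\<^bsub>quot_space V W\<^esub> (W +>\<^bsub>V\<^esub> w) = W +>\<^bsub>V\<^esub> (v \<oplus>\<^bsub>V\<^esub> w)"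
proof -
  interpret W: abelian_subgroup W V by (rule submodule_abelian_subgroup) fact
  show ?thesis using assms(2,3) by (simp add: quot_space_def W.a_rcos_sum)
qed

lemma quot_space_smult:
  assumes "submodule R W V" "a \<in> carrier R" "v \<in> carrier V"
  shows "a \<odot>\<^bsub>quot_space V W\<^esub> (W +>\<^bsub>V\<^esub> v) = W +>\<^bsub>V\<^esub> (a \<odot>\<^bsub>V\<^esub> v)"
proof -
  interpret W: submodule R W V by fact
  interpret V: module R V by (rule W.module)
  interpret W': abelian_subgroup W V by (rule submodule_abelian_subgroup) fact
  have *: "W +>\<^bsub>V\<^esub> (a \<odot>\<^bsub>V\<^esub> u) = W +>\<^bsub>V\<^esub> (a \<odot>\<^bsub>V\<^esub> v)" if "u \<in> W +>\<^bsub>V\<^esub> v" for u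
  proof -
    have u: "u \<in> carrier V" using that assms(3) W'.a_elemrcos_carrier by blast
    have "u \<ominus>\<^bsub>V\<^esub> v \<in> W" using that u assms(3) W'.a_rcos_module by (simp add: a_minus_def)
    then have "a \<odot>\<^bsub>V\<^esub> (u \<ominus>\<^bsub>V\<^esub> v) \<in> W" using assms(2) by simp
    then show ?thesis
      using u assms by (simp add: coset_eq_iff a_minus_def V.smult_r_distr V.smult_r_minus)
  qed
  have v: "v \<in> W +>\<^bsub>V\<^esub> v" using assms(3) by (rule W'.a_rcos_self)
  have "a \<odot>\<^bsub>quot_space V W\<^esub> (W +>\<^bsub>V\<^esub> v) = (\<Union>u\<in>W +>\<^bsub>V\<^esub> v. W +>\<^bsub>V\<^esub> (a \<odot>\<^bsub>V\<^esub> u))"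
    by (simp add: quot_space_def)
  also have "\<dots> = (\<Union>u\<in>W +>\<^bsub>V\<^esub> v. W +>\<^bsub>V\<^esub> (a \<odot>\<^bsub>V\<^esub> v))"
    by (rule SUP_cong[OF refl *])
  also have "\<dots> = W +>\<^bsub>V\<^esub> (a \<odot>\<^bsub>V\<^esub> v)"
    using v by blast
  finally show ?thesis .
qed

lemma quot_space_module:
  assumes W: "submodule R W V"
  shows "module R (quot_space V W)"
proof -
  interpret W: submodule R W V by fact
  interpret V: module R V by (rule W.module)
  note simps = quot_space_carrier quot_space_zero[OF W] quot_space_add[OF W] quot_space_smult[OF W]
  have "abelian_group (quot_space V W)"
  proof (rule abelian_groupI)
    fix x assume "x \<in> carrier (quot_space V W)"
    then obtain v where v: "v \<in> carrier V" "x = W +>\<^bsub>V\<^esub> v" by (auto simp: simps)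
    then have "W +>\<^bsub>V\<^esub> (\<ominus>\<^bsub>V\<^esub> v) \<in> carrier (quot_space V W)"
      "(W +>\<^bsub>V\<^esub> (\<ominus>\<^bsub>V\<^esub> v)) \<oplus>\<^bsub>quot_space V W\<^esub> x = \<zero>\<^bsub>quot_space V W\<^esub>"
      by (auto simp: simps V.M.l_neg)
    then show "\<exists>y\<in>carrier (quot_space V W). y \<oplus>\<^bsub>quot_space V W\<^esub> x = \<zero>\<^bsub>quot_space V W\<^esub>"
      by blast
  qed (auto simp: simps V.M.a_ac)
  then show ?thesis
    by (rule moduleI[OF is_cring])
      (auto simp: simps V.smult_l_distr V.smult_r_distr V.smult_assoc1)
qed

lemma coset_hom:
  assumes W: "submodule R W V"
  shows "(\<lambda>v. W +>\<^bsub>V\<^esub> v) \<in> module_hom R V (quot_space V W)"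
  by (rule module_homI) (auto simp: quot_space_carrier quot_space_add[OF W] quot_space_smult[OF W])

lemma quot_space_lift:
  assumes W: "submodule R W V" and U: "module R U" and f: "f \<in> module_hom R V U"
    and f0: "\<And>w. w \<in> W \<Longrightarrow> f w = \<zero>\<^bsub>U\<^esub>"
  obtains h where "h \<in> module_hom R (quot_space V W) U" "\<And>v. v \<in> carrier V \<Longrightarrow> h (W +>\<^bsub>V\<^esub> v) = f v"
proof -
  interpret W: submodule R W V by fact
  interpret V: module R V by (rule W.module)
  interpret U: module R U by fact
  \<comment> \<open>\<open>h\<close> evaluates \<open>f\<close> at an arbitrarily chosen
    representative; two representatives differ by an element of \<open>W\<close>, which
    \<open>f\<close> annihilates.\<close>
  define h where "h A = f (SOME v. v \<in> carrier V \<and> A = W +>\<^bsub>V\<^esub> v)" for A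
  have h: "h (W +>\<^bsub>V\<^esub> v) = f v" if v: "v \<in> carrier V" for v
  proof -
    define u where "u = (SOME u. u \<in> carrier V \<and> W +>\<^bsub>V\<^esub> v = W +>\<^bsub>V\<^esub> u)"
    have u: "u \<in> carrier V \<and> W +>\<^bsub>V\<^esub> v = W +>\<^bsub>V\<^esub> u"
      unfolding u_def by (rule someI[of _ v]) (use v in simp)
    then have "v \<ominus>\<^bsub>V\<^esub> u \<in> W" using v coset_eq_iff[OF W, of v u] by blast
    then have "f v \<ominus>\<^bsub>U\<^esub> f u = \<zero>\<^bsub>U\<^esub>"
      using f0 module_hom_minus[OF V.module_axioms U f] u v by metis
    then have "f v = f u" using u v module_hom_in_carrier[OF f] by simp
    then show ?thesis by (simp add: h_def u_def)
  qed
  have "h \<in> module_hom R (quot_space V W) U"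
    by (rule module_homI)
      (auto simp: quot_space_carrier quot_space_add[OF W] quot_space_smult[OF W] h
        module_hom_in_carrier[OF f] module_hom_add[OF f] module_hom_smult[OF f])
  then show thesis using that h by blast
qed

section \<open>Bilinear maps and the universal property of the tensor product\<close>

definition bilinear_map ::
  "('a, 'v) module \<Rightarrow> ('a, 'w) module \<Rightarrow> ('a, 'u) module \<Rightarrow> ('v \<Rightarrow> 'w \<Rightarrow> 'u) \<Rightarrow> bool"
  where "bilinear_map V W U b \<longleftrightarrow>
    (\<forall>v\<in>carrier V. (\<lambda>w. b v w) \<in> module_hom R W U) \<and>
    (\<forall>w\<in>carrier W. (\<lambda>v. b v w) \<in> module_hom R V U)"

context
  fixes V :: "('a, 'v) module" and W :: "('a, 'w) module"
  assumes V: "module R V" and W: "module R W"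
begin

interpretation V: module R V by (rule V)
interpretation W: module R W by (rule W)

abbreviation (input) "F \<equiv> free_space R (carrier V \<times> carrier W)"

interpretation F: module R F by (rule free_space_module)

lemma tensor_relators_closed: "tensor_relators R V W \<subseteq> carrier F"
  unfolding tensor_relators_def Let_def
  by (auto intro!: F.M.minus_closed F.M.a_closed F.smult_closed basis_vec_closed)

lemma tensor_kernel_submodule: "submodule R (tensor_kernel R V W) F"
  unfolding tensor_kernel_def by (rule F.span_is_submodule[OF tensor_relators_closed])

lemma tensor_space_module: "module R (tensor_space R V W)"
  unfolding tensor_space_def by (rule quot_space_module[OF tensor_kernel_submodule])

lemma tensor_closed:
  "\<lbrakk>v \<in> carrier V; w \<in> carrier W\<rbrakk> \<Longrightarrow> tensor R V W v w \<in> carrier (tensor_space R V W)"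
  by (auto simp: tensor_space_def tensor_def quot_space_carrier basis_vec_closed)

lemma tensor_relation:
  assumes "f \<ominus>\<^bsub>F\<^esub> g \<in> tensor_relators R V W" "f \<in> carrier F" "g \<in> carrier F"
  shows "tensor_kernel R V W +>\<^bsub>F\<^esub> f = tensor_kernel R V W +>\<^bsub>F\<^esub> g"
proof -
  have "f \<ominus>\<^bsub>F\<^esub> g \<in> tensor_kernel R V W"
    using assms(1) F.in_own_span[OF tensor_relators_closed] unfolding tensor_kernel_def by blast
  then show ?thesis
    using coset_eq_iff[OF tensor_kernel_submodule assms(2,3)] by blast
qed

lemmas tensor_quot_simps =
  quot_space_add[OF tensor_kernel_submodule, symmetric]
  quot_space_smult[OF tensor_kernel_submodule, symmetric]

text \<open>Additivity and homogeneity in each argument correspond one by one to the four families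
  of relators, each of which becomes an equality of cosets.\<close>

lemma tensor_bilinear: "bilinear_map V W (tensor_space R V W) (tensor R V W)"
  unfolding bilinear_map_def
proof (intro conjI ballI)
  let ?d = "\<lambda>v w. basis_vec R (carrier V \<times> carrier W) (v, w)"
  fix v assume v: "v \<in> carrier V"
  show "tensor R V W v \<in> module_hom R W (tensor_space R V W)"
  proof (rule module_homI)
    fix w w' assume w: "w \<in> carrier W" "w' \<in> carrier W"
    have "?d v (w \<oplus>\<^bsub>W\<^esub> w') \<ominus>\<^bsub>F\<^esub> (?d v w \<oplus>\<^bsub>F\<^esub> ?d v w') \<in> tensor_relators R V W"
      unfolding tensor_relators_def Let_def using v w by blast
    from tensor_relation[OF this] show "tensor R V W v (w \<oplus>\<^bsub>W\<^esub> w') =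
        tensor R V W v w \<oplus>\<^bsub>tensor_space R V W\<^esub> tensor R V W v w'"
      using v w by (simp add: tensor_def tensor_space_def tensor_quot_simps basis_vec_closed)
  next
    fix a w assume a: "a \<in> carrier R" and w: "w \<in> carrier W"
    have "?d v (a \<odot>\<^bsub>W\<^esub> w) \<ominus>\<^bsub>F\<^esub> (a \<odot>\<^bsub>F\<^esub> ?d v w) \<in> tensor_relators R V W"
      unfolding tensor_relators_def Let_def using v w a by blast
    from tensor_relation[OF this] show "tensor R V W v (a \<odot>\<^bsub>W\<^esub> w) =
        a \<odot>\<^bsub>tensor_space R V W\<^esub> tensor R V W v w"
      using v w a by (simp add: tensor_def tensor_space_def tensor_quot_simps basis_vec_closed)
  qed (simp add: v tensor_closed)
next
  let ?d = "\<lambda>v w. basis_vec R (carrier V \<times> carrier W) (v, w)"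
  fix w assume w: "w \<in> carrier W"
  show "(\<lambda>v. tensor R V W v w) \<in> module_hom R V (tensor_space R V W)"
  proof (rule module_homI)
    fix v v' assume v: "v \<in> carrier V" "v' \<in> carrier V"
    have "?d (v \<oplus>\<^bsub>V\<^esub> v') w \<ominus>\<^bsub>F\<^esub> (?d v w \<oplus>\<^bsub>F\<^esub> ?d v' w) \<in> tensor_relators R V W"
      unfolding tensor_relators_def Let_def using v w by blast
    from tensor_relation[OF this] show "tensor R V W (v \<oplus>\<^bsub>V\<^esub> v') w =
        tensor R V W v w \<oplus>\<^bsub>tensor_space R V W\<^esub> tensor R V W v' w"
      using v w by (simp add: tensor_def tensor_space_def tensor_quot_simps basis_vec_closed)
  next
    fix a v assume a: "a \<in> carrier R" and v: "v \<in> carrier V"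
    have "?d (a \<odot>\<^bsub>V\<^esub> v) w \<ominus>\<^bsub>F\<^esub> (a \<odot>\<^bsub>F\<^esub> ?d v w) \<in> tensor_relators R V W"
      unfolding tensor_relators_def Let_def using v w a by blast
    from tensor_relation[OF this] show "tensor R V W (a \<odot>\<^bsub>V\<^esub> v) w =
        a \<odot>\<^bsub>tensor_space R V W\<^esub> tensor R V W v w"
      using v w a by (simp add: tensor_def tensor_space_def tensor_quot_simps basis_vec_closed)
  qed (simp add: w tensor_closed)
qed

lemma tensor_hom_right: "v \<in> carrier V \<Longrightarrow> tensor R V W v \<in> module_hom R W (tensor_space R V W)"
  and tensor_hom_left:
    "w \<in> carrier W \<Longrightarrow> (\<lambda>v. tensor R V W v w) \<in> module_hom R V (tensor_space R V W)"
  using tensor_bilinear by (auto simp: bilinear_map_def)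

text \<open>Comes from induction over the free space that covers the tensor product. No scalar
  appears in the step because a coefficient can be absorbed into the left factor.\<close>

lemma tensor_induct [consumes 1, case_names zero add]:
  assumes "t \<in> carrier (tensor_space R V W)"
    and zero: "P \<zero>\<^bsub>tensor_space R V W\<^esub>"
    and step: "\<And>v w t. \<lbrakk>v \<in> carrier V; w \<in> carrier W; t \<in> carrier (tensor_space R V W); P t\<rbrakk> \<Longrightarrow>
      P (tensor R V W v w \<oplus>\<^bsub>tensor_space R V W\<^esub> t)"
  shows "P t"
proof -
  let ?q = "\<lambda>f. tensor_kernel R V W +>\<^bsub>F\<^esub> f"
  obtain f where f: "f \<in> carrier F" "t = ?q f"
    using assms(1) by (auto simp: tensor_space_def quot_space_carrier)
  have "P (?q f)"
    using f(1)
  proof (induction rule: free_space_induct)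
    case zero
    then show ?case
      using assms(2) by (simp add: tensor_space_def quot_space_zero[OF tensor_kernel_submodule])
  next
    case (add a s c)
    obtain v w where s: "s = (v, w)" "v \<in> carrier V" "w \<in> carrier W" using add by auto
    have "?q (a \<odot>\<^bsub>F\<^esub> basis_vec R (carrier V \<times> carrier W) s \<oplus>\<^bsub>F\<^esub> c) =
        a \<odot>\<^bsub>tensor_space R V W\<^esub> tensor R V W v w \<oplus>\<^bsub>tensor_space R V W\<^esub> ?q c"
      using add s by (simp add: tensor_def tensor_space_def tensor_quot_simps basis_vec_closed)
    also have "a \<odot>\<^bsub>tensor_space R V W\<^esub> tensor R V W v w = tensor R V W (a \<odot>\<^bsub>V\<^esub> v) w"
      using add s by (simp add: module_hom_smult[OF tensor_hom_left])
    finally have eq: "?q (a \<odot>\<^bsub>F\<^esub> basis_vec R (carrier V \<times> carrier W) s \<oplus>\<^bsub>F\<^esub> c) =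
      tensor R V W (a \<odot>\<^bsub>V\<^esub> v) w \<oplus>\<^bsub>tensor_space R V W\<^esub> ?q c" .
    have "?q c \<in> carrier (tensor_space R V W)"
      using add by (simp add: tensor_space_def quot_space_carrier)
    then show ?case
      unfolding eq using add s by (intro step) auto
  qed
  then show ?thesis using f by simp
qed

lemma tensor_hom_eqI:
  assumes "module R U" "h \<in> module_hom R (tensor_space R V W) U" "k \<in> module_hom R (tensor_space R V W) U"
    and "\<And>v w. \<lbrakk>v \<in> carrier V; w \<in> carrier W\<rbrakk> \<Longrightarrow> h (tensor R V W v w) = k (tensor R V W v w)"
    and "t \<in> carrier (tensor_space R V W)"
  shows "h t = k t"
  using assms(5)
proof (induction rule: tensor_induct)
  case zero
  then show ?case using assms(1-3) tensor_space_module by (metis module_hom_zero)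
next
  case (add v w t)
  then show ?case using assms(2-4) by (simp add: module_hom_add tensor_closed)
qed

text \<open>The linear extension of \<open>b\<close> to the free space on all pairs kills every
  relator, by bilinearity. Its kernel is a submodule, hence contains their span, and the map
  descends to the quotient.\<close>

lemma tensor_lift_exists:
  assumes U: "module R U" and b: "bilinear_map V W U b"
  obtains h where "h \<in> module_hom R (tensor_space R V W) U"
    "\<And>v w. \<lbrakk>v \<in> carrier V; w \<in> carrier W\<rbrakk> \<Longrightarrow> h (tensor R V W v w) = b v w"
proof -
  interpret U: module R U by fact
  let ?f = "lin_ext R (carrier V \<times> carrier W) U (\<lambda>(v, w). b v w)"
  have b1: "b v \<in> module_hom R W U" if "v \<in> carrier V" for v
    using b that by (auto simp: bilinear_map_def)
  have b2: "(\<lambda>v. b v w) \<in> module_hom R V U" if "w \<in> carrier W" for w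
    using b that by (auto simp: bilinear_map_def)
  have bc: "b v w \<in> carrier U" if "v \<in> carrier V" "w \<in> carrier W" for v w
    using b1 that module_hom_in_carrier by metis
  then have g: "(\<lambda>(v, w). b v w) \<in> carrier V \<times> carrier W \<rightarrow> carrier U" by auto
  note f = lin_ext_hom[OF U g]
  note fs = lin_ext_basis_vec[OF U g] module_hom_add[OF f] module_hom_smult[OF f]
    module_hom_minus[OF free_space_module U f] basis_vec_closed
    module_hom_add[OF b1] module_hom_smult[OF b1] module_hom_add[OF b2] module_hom_smult[OF b2] bc
  interpret f: mod_hom R F U ?f
    using f by (simp add: mod_hom_def mod_hom_axioms_def F.module_axioms U)
  have "tensor_relators R V W \<subseteq> f.ker"
    unfolding tensor_relators_def Let_def f.ker_def
    by (auto simp: fs intro!: F.M.minus_closed F.M.a_closed F.smult_closed)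
  then have "tensor_kernel R V W \<subseteq> f.ker"
    unfolding tensor_kernel_def by (rule F.span_is_subset[OF _ f.ker_is_submodule])
  then have "?f x = \<zero>\<^bsub>U\<^esub>" if "x \<in> tensor_kernel R V W" for x
    using that by (auto simp: f.ker_def)
  from quot_space_lift[OF tensor_kernel_submodule U f this] obtain h where
    h: "h \<in> module_hom R (tensor_space R V W) U"
      "\<And>x. x \<in> carrier F \<Longrightarrow> h (tensor_kernel R V W +>\<^bsub>F\<^esub> x) = ?f x"
    by (auto simp: tensor_space_def)
  show thesis
    by (rule that[OF h(1)]) (auto simp: tensor_def h(2) fs)
qed

text \<open>Justifies the definite description: pure tensors generate, so two lifts agree on the
  carrier, and extensionality fixes the values elsewhere. The witness is therefore a restriction of
  the map found above.\<close>

lemma tensor_lift: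
  assumes U: "module R U" and b: "bilinear_map V W U b"
  shows tensor_lift_hom: "tensor_lift R V W U b \<in> module_hom R (tensor_space R V W) U"
    and tensor_lift_tensor:
      "\<And>v w. \<lbrakk>v \<in> carrier V; w \<in> carrier W\<rbrakk> \<Longrightarrow> tensor_lift R V W U b (tensor R V W v w) = b v w"
proof -
  interpret T: module R "tensor_space R V W" by (rule tensor_space_module)
  let ?T = "carrier (tensor_space R V W)"
  let ?P = "\<lambda>h. h \<in> module_hom R (tensor_space R V W) U \<inter> extensional ?T \<and>
    (\<forall>v\<in>carrier V. \<forall>w\<in>carrier W. h (tensor R V W v w) = b v w)"
  obtain h where h: "h \<in> module_hom R (tensor_space R V W) U"
    "\<And>v w. \<lbrakk>v \<in> carrier V; w \<in> carrier W\<rbrakk> \<Longrightarrow> h (tensor R V W v w) = b v w"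
    using tensor_lift_exists[OF assms] by metis
  have "restrict h ?T \<in> module_hom R (tensor_space R V W) U"
    using h(1) by (intro module_homI)
      (auto simp: module_hom_in_carrier module_hom_add module_hom_smult)
  then have P: "?P (restrict h ?T)" using h(2) by (auto simp: tensor_closed)
  have "k = restrict h ?T" if "?P k" for k
  proof (rule extensionalityI)
    fix t assume "t \<in> ?T"
    then show "k t = restrict h ?T t"
      using that P by (intro tensor_hom_eqI[OF U, of k "restrict h ?T" t]) auto
  qed (use that in auto)
  with P have "?P (tensor_lift R V W U b)"
    unfolding tensor_lift_def by (rule theI)
  then show "tensor_lift R V W U b \<in> module_hom R (tensor_space R V W) U"
    "\<And>v w. \<lbrakk>v \<in> carrier V; w \<in> carrier W\<rbrakk> \<Longrightarrow> tensor_lift R V W U b (tensor R V W v w) = b v w"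
    by auto
qed

end

end

section \<open>Interchange of iterated finite sums with dependent ranges\<close>

context abelian_monoid
begin

lemma finsum_Sigma:
  assumes "finite A" "\<And>x. x \<in> A \<Longrightarrow> finite (B x)"
    and "\<And>x y. \<lbrakk>x \<in> A; y \<in> B x\<rbrakk> \<Longrightarrow> f x y \<in> carrier G"
  shows "(\<Oplus>x\<in>A. \<Oplus>y\<in>B x. f x y) = (\<Oplus>p\<in>Sigma A B. f (fst p) (snd p))"
  using assms
proof (induction A rule: finite_induct)
  case empty
  then show ?case by simp
next
  case (insert a A)
  have "(\<Oplus>p\<in>Sigma (insert a A) B. f (fst p) (snd p)) =
      (\<Oplus>p\<in>Pair a ` B a \<union> Sigma A B. f (fst p) (snd p))"
    by (rule arg_cong2[where f = "finsum G"]) auto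
  also have "\<dots> = (\<Oplus>p\<in>Pair a ` B a. f (fst p) (snd p)) \<oplus> (\<Oplus>p\<in>Sigma A B. f (fst p) (snd p))"
    using insert by (intro finsum_Un_disjoint) auto
  also have "(\<Oplus>p\<in>Pair a ` B a. f (fst p) (snd p)) = (\<Oplus>y\<in>B a. f a y)"
    using insert.prems by (subst finsum_reindex) (auto simp: inj_on_def)
  also have "(\<Oplus>p\<in>Sigma A B. f (fst p) (snd p)) = (\<Oplus>x\<in>A. \<Oplus>y\<in>B x. f x y)"
    using insert by auto
  finally show ?case
    using insert by (subst finsum_insert) (auto intro!: finsum_closed)
qed

text \<open>Both iterated sums run over the same set of pairs, up to swapping the components.
  Coassociativity needs this, because there the inner range is an interval that depends on the outer
  index.\<close>

lemma finsum_swap_dependent: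
  assumes "finite A" "\<And>x. x \<in> A \<Longrightarrow> finite (B x)" "finite C" "\<And>y. y \<in> C \<Longrightarrow> finite (D y)"
    and iff: "\<And>x y. x \<in> A \<and> y \<in> B x \<longleftrightarrow> y \<in> C \<and> x \<in> D y"
    and f: "\<And>x y. \<lbrakk>x \<in> A; y \<in> B x\<rbrakk> \<Longrightarrow> f x y \<in> carrier G"
  shows "(\<Oplus>x\<in>A. \<Oplus>y\<in>B x. f x y) = (\<Oplus>y\<in>C. \<Oplus>x\<in>D y. f x y)"
proof -
  have "(\<Oplus>x\<in>A. \<Oplus>y\<in>B x. f x y) = (\<Oplus>p\<in>Sigma A B. f (fst p) (snd p))"
    using assms by (intro finsum_Sigma) auto
  also have "Sigma A B = prod.swap ` Sigma C D"
    using iff by force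
  also have "(\<Oplus>p\<in>prod.swap ` Sigma C D. f (fst p) (snd p)) = (\<Oplus>p\<in>Sigma C D. f (snd p) (fst p))"
    using f iff[THEN iffD2] by (subst finsum_reindex) auto
  also have "\<dots> = (\<Oplus>y\<in>C. \<Oplus>x\<in>D y. f x y)"
    using assms(3,4) f iff[THEN iffD2] by (intro finsum_Sigma[symmetric]) auto
  finally show ?thesis .
qed

end

section \<open>Tensor products of maps, associativity, spanning families and dual spaces\<close>

context cring
begin

lemma tensor_map_bilinear:
  assumes "module R V'" "module R W'" "f \<in> module_hom R V V'" "g \<in> module_hom R W W'"
  shows "bilinear_map V W (tensor_space R V' W') (\<lambda>v w. tensor R V' W' (f v) (g w))"
  unfolding bilinear_map_def
  using module_hom_comp[OF tensor_hom_right[OF assms(1,2)] assms(4)]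
    module_hom_comp[OF tensor_hom_left[OF assms(1,2)] assms(3)]
    module_hom_in_carrier[OF assms(3)] module_hom_in_carrier[OF assms(4)]
  by auto

lemma tensor_map_hom:
  assumes "module R V" "module R W" "module R V'" "module R W'"
    and "f \<in> module_hom R V V'" "g \<in> module_hom R W W'"
  shows "tensor_map R V W V' W' f g \<in> module_hom R (tensor_space R V W) (tensor_space R V' W')"
  unfolding tensor_map_def using assms
  by (intro tensor_lift_hom tensor_space_module tensor_map_bilinear)

lemma tensor_map_tensor:
  assumes "module R V" "module R W" "module R V'" "module R W'"
    and "f \<in> module_hom R V V'" "g \<in> module_hom R W W'" "v \<in> carrier V" "w \<in> carrier W"
  shows "tensor_map R V W V' W' f g (tensor R V W v w) = tensor R V' W' (f v) (g w)"
  unfolding tensor_map_def using assms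
  by (intro tensor_lift_tensor tensor_space_module tensor_map_bilinear)

context
  fixes U :: "('a, 'u) module" and V :: "('a, 'v) module" and W :: "('a, 'w) module"
  assumes U: "module R U" and V: "module R V" and W: "module R W"
begin

abbreviation (input) "VW \<equiv> tensor_space R V W"
abbreviation (input) "UVW \<equiv> tensor_space R U VW"

lemma VW: "module R VW"
  by (rule tensor_space_module[OF V W])

lemma UVW: "module R UVW"
  by (rule tensor_space_module[OF U VW])

lemma tensor_assoc_inner_bilinear:
  assumes "w \<in> carrier W"
  shows "bilinear_map U V UVW (\<lambda>u v. tensor R U VW u (tensor R V W v w))"
  unfolding bilinear_map_def
  using assms module_hom_comp[OF tensor_hom_right[OF U VW] tensor_hom_left[OF V W]]
    tensor_hom_left[OF U VW] tensor_closed[OF V W]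
  by auto

abbreviation (input) "assoc_inner w \<equiv>
  tensor_lift R U V UVW (\<lambda>u v. tensor R U VW u (tensor R V W v w))"

text \<open>Linearity in \<open>t\<close> is built into the inner lift. Linearity in
  \<open>w\<close> is an identity between different lifts, hence between linear maps in
  \<open>t\<close>, and so it suffices to compare them on pure tensors.\<close>

lemma tensor_assoc_bilinear: "bilinear_map (tensor_space R U V) W UVW (\<lambda>t w. assoc_inner w t)"
  unfolding bilinear_map_def
proof (intro conjI ballI)
  fix w assume "w \<in> carrier W"
  then show "(\<lambda>t. assoc_inner w t) \<in> module_hom R (tensor_space R U V) UVW"
    by (rule tensor_lift_hom[OF U V UVW tensor_assoc_inner_bilinear])
next
  interpret W: module R W by (rule W)
  note lh = tensor_lift_hom[OF U V UVW tensor_assoc_inner_bilinear]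
  note lt = tensor_lift_tensor[OF U V UVW tensor_assoc_inner_bilinear]
  fix t assume t: "t \<in> carrier (tensor_space R U V)"
  show "(\<lambda>w. assoc_inner w t) \<in> module_hom R W UVW"
  proof (rule module_homI)
    fix w assume "w \<in> carrier W"
    then show "assoc_inner w t \<in> carrier UVW" by (intro module_hom_in_carrier[OF lh] t)
  next
    fix w w' assume w: "w \<in> carrier W" "w' \<in> carrier W"
    show "assoc_inner (w \<oplus>\<^bsub>W\<^esub> w') t = assoc_inner w t \<oplus>\<^bsub>UVW\<^esub> assoc_inner w' t"
    proof (rule tensor_hom_eqI[OF U V UVW lh module_hom_sum[OF UVW lh lh] _ t])
      fix u v assume uv: "u \<in> carrier U" "v \<in> carrier V"
      show "assoc_inner (w \<oplus>\<^bsub>W\<^esub> w') (tensor R U V u v) =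
          assoc_inner w (tensor R U V u v) \<oplus>\<^bsub>UVW\<^esub> assoc_inner w' (tensor R U V u v)"
        using uv w by (simp add: lt module_hom_add[OF tensor_hom_right[OF V W]] tensor_closed[OF V W]
            module_hom_add[OF tensor_hom_right[OF U VW]])
    qed (use w in auto)
  next
    fix a w assume w: "w \<in> carrier W" and a: "a \<in> carrier R"
    show "assoc_inner (a \<odot>\<^bsub>W\<^esub> w) t = a \<odot>\<^bsub>UVW\<^esub> assoc_inner w t"
    proof (rule tensor_hom_eqI[OF U V UVW lh module_hom_scale[OF UVW lh] _ t])
      fix u v assume uv: "u \<in> carrier U" "v \<in> carrier V"
      show "assoc_inner (a \<odot>\<^bsub>W\<^esub> w) (tensor R U V u v) = a \<odot>\<^bsub>UVW\<^esub> assoc_inner w (tensor R U V u v)"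
        using uv w a by (simp add: lt module_hom_smult[OF tensor_hom_right[OF V W]] tensor_closed[OF V W]
            module_hom_smult[OF tensor_hom_right[OF U VW]])
    qed (use w a in auto)
  qed
qed

lemma tensor_assoc_hom:
  "tensor_assoc R U V W \<in> module_hom R (tensor_space R (tensor_space R U V) W) UVW"
  unfolding tensor_assoc_def Let_def
  by (rule tensor_lift_hom[OF tensor_space_module[OF U V] W UVW tensor_assoc_bilinear])

lemma tensor_assoc_tensor:
  assumes "u \<in> carrier U" "v \<in> carrier V" "w \<in> carrier W"
  shows "tensor_assoc R U V W (tensor R (tensor_space R U V) W (tensor R U V u v) w) =
    tensor R U VW u (tensor R V W v w)"
  unfolding tensor_assoc_def Let_def using assms
  by (simp add: tensor_lift_tensor[OF tensor_space_module[OF U V] W UVW tensor_assoc_bilinear]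
      tensor_closed[OF U V] tensor_lift_tensor[OF U V UVW tensor_assoc_inner_bilinear])

end

text \<open>Pulling both maps back along the surjection from the free space reduces the claim to
  basis vectors; relations among the \<open>e s\<close> do no harm.\<close>

lemma spanning_hom_eqI:
  assumes D: "module R D" and U: "module R U" and e: "e \<in> S \<rightarrow> carrier D"
    and span: "lin_ext R S D e ` carrier (free_space R S) = carrier D"
    and h: "h \<in> module_hom R D U" and k: "k \<in> module_hom R D U"
    and eq: "\<And>s. s \<in> S \<Longrightarrow> h (e s) = k (e s)"
    and d: "d \<in> carrier D"
  shows "h d = k d"
proof -
  obtain c where c: "c \<in> carrier (free_space R S)" "d = lin_ext R S D e c"
    using d span by blast
  note l = lin_ext_hom[OF D e]
  show ?thesis
    unfolding c(2)
    using free_space_hom_eqI[OF U module_hom_comp[OF h l] module_hom_comp[OF k l] _ c(1)]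
    by (simp add: lin_ext_basis_vec[OF D e] eq)
qed

lemma coset_eq_zero_iff:
  assumes W: "submodule R W V" and v: "v \<in> carrier V"
  shows "W +>\<^bsub>V\<^esub> v = \<zero>\<^bsub>quot_space V W\<^esub> \<longleftrightarrow> v \<in> W"
proof -
  interpret W: submodule R W V by fact
  interpret V: module R V by (rule W.module)
  have "\<ominus>\<^bsub>V\<^esub> \<zero>\<^bsub>V\<^esub> = \<zero>\<^bsub>V\<^esub>"
    by (rule V.M.minus_equality) auto
  then have "v \<ominus>\<^bsub>V\<^esub> \<zero>\<^bsub>V\<^esub> = v" using v by (simp add: a_minus_def)
  then show ?thesis
    unfolding quot_space_zero[OF W] using coset_eq_iff[OF W v V.M.zero_closed] by simp
qed

lemma free_space_hom_range:
  assumes h: "h \<in> module_hom R (free_space R S) U" and M: "submodule R M U"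
    and basis: "\<And>s. s \<in> S \<Longrightarrow> h (basis_vec R S s) \<in> M" and c: "c \<in> carrier (free_space R S)"
  shows "h c \<in> M"
proof -
  interpret F: module R "free_space R S" by (rule free_space_module)
  interpret M: submodule R M U by (rule M)
  show ?thesis
    using c
  proof (induction rule: free_space_induct)
    case zero
    then show ?case using module_hom_zero[OF F.module_axioms M.module h] by simp
  next
    case (add a s c)
    then show ?case
      by (simp add: module_hom_add[OF h] module_hom_smult[OF h] basis_vec_closed basis)
  qed
qed

text \<open>The image of \<open>?L\<close> is a submodule, so one factor can be expanded at a time:
  it contains the tensors of generators, then those of a generator with an arbitrary vector, then
  all pure tensors, and these generate.\<close>

lemma tensor_space_span:
  assumes V: "module R V" and W: "module R W" and e: "e \<in> S \<rightarrow> carrier V" and e': "e' \<in> S' \<rightarrow> carrier W"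
    and span: "lin_ext R S V e ` carrier (free_space R S) = carrier V"
    and span': "lin_ext R S' W e' ` carrier (free_space R S') = carrier W"
  shows "lin_ext R (S \<times> S') (tensor_space R V W) (\<lambda>(s, s'). tensor R V W (e s) (e' s')) `
    carrier (free_space R (S \<times> S')) = carrier (tensor_space R V W)" (is "?L ` _ = _")
proof -
  let ?T = "tensor_space R V W"
  have T: "module R ?T" by (rule tensor_space_module[OF V W])
  have g: "(\<lambda>(s, s'). tensor R V W (e s) (e' s')) \<in> S \<times> S' \<rightarrow> carrier ?T"
    using e e' by (auto intro!: tensor_closed[OF V W])
  note L = lin_ext_hom[OF T g]
  interpret L: mod_hom R "free_space R (S \<times> S')" ?T ?L
    using L by (simp add: mod_hom_def mod_hom_axioms_def free_space_module T)
  interpret im: submodule R L.im ?T by (rule L.im_is_submodule)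
  have base: "tensor R V W (e s) (e' s') \<in> L.im" if "s \<in> S" "s' \<in> S'" for s s'
    using lin_ext_basis_vec[OF T g, of "(s, s')"] basis_vec_closed[of "(s, s')" "S \<times> S'"] that
    unfolding L.im_def by force
  have right: "tensor R V W (e s) w \<in> L.im" if s: "s \<in> S" and w: "w \<in> carrier W" for s w
  proof -
    obtain c where c: "c \<in> carrier (free_space R S')" "w = lin_ext R S' W e' c"
      using w span' by blast
    have "e s \<in> carrier V" using s e by auto
    from module_hom_comp[OF tensor_hom_right[OF V W this] lin_ext_hom[OF W e']]
    show ?thesis
      unfolding c(2) using im.submodule_axioms _ c(1)
      by (rule free_space_hom_range) (simp add: lin_ext_basis_vec[OF W e'] base s)
  qed
  have both: "tensor R V W v w \<in> L.im" if v: "v \<in> carrier V" and w: "w \<in> carrier W" for v w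
  proof -
    obtain c where c: "c \<in> carrier (free_space R S)" "v = lin_ext R S V e c"
      using v span by blast
    from module_hom_comp[OF tensor_hom_left[OF V W w] lin_ext_hom[OF V e]]
    show ?thesis
      unfolding c(2) using im.submodule_axioms _ c(1)
      by (rule free_space_hom_range) (simp add: lin_ext_basis_vec[OF V e] right w)
  qed
  have "t \<in> L.im" if "t \<in> carrier ?T" for t
    using that by (induction rule: tensor_induct[OF V W, consumes 1]) (auto simp: both)
  then show ?thesis
    using im.subset unfolding L.im_def by blast
qed

text \<open>Supplies the shape of presentation over which \<open>finite_dual_comult\<close>
  quantifies: finitely many pure tensors indexed by an initial segment of the naturals.\<close>

lemma tensor_space_finsum:
  assumes V: "module R V" and W: "module R W" and t: "t \<in> carrier (tensor_space R V W)"
  obtains n :: nat and u v where "\<forall>i<n. u i \<in> carrier V \<and> v i \<in> carrier W"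
    "t = (\<Oplus>\<^bsub>tensor_space R V W\<^esub> i\<in>{..<n}. tensor R V W (u i) (v i))"
proof -
  let ?T = "tensor_space R V W"
  interpret T: module R ?T by (rule tensor_space_module[OF V W])
  have "\<exists>(n::nat) u v. (\<forall>i<n. u i \<in> carrier V \<and> v i \<in> carrier W) \<and>
    t = (\<Oplus>\<^bsub>?T\<^esub> i\<in>{..<n}. tensor R V W (u i) (v i))"
    using t
  proof (induction rule: tensor_induct[OF V W, consumes 1, case_names zero add])
    case zero
    show ?case by (rule exI[of _ 0]) simp
  next
    case (add v w t)
    then obtain n :: nat and u' v' where uv: "\<forall>i<n. u' i \<in> carrier V \<and> v' i \<in> carrier W"
      "t = (\<Oplus>\<^bsub>?T\<^esub> i\<in>{..<n}. tensor R V W (u' i) (v' i))" by blast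
    \<comment> \<open>The new summand is stored at the free index \<open>n\<close>, which the old
      sum over indices below \<open>n\<close> does not see.\<close>
    have "(\<Oplus>\<^bsub>?T\<^esub> i\<in>{..<n}. tensor R V W ((u'(n := v)) i) ((v'(n := w)) i)) = t"
      unfolding uv(2) using uv(1) by (intro T.M.finsum_cong') (auto intro!: tensor_closed[OF V W])
    then have "tensor R V W v w \<oplus>\<^bsub>?T\<^esub> t =
      (\<Oplus>\<^bsub>?T\<^esub> i\<in>{..<Suc n}. tensor R V W ((u'(n := v)) i) ((v'(n := w)) i))"
      unfolding lessThan_Suc using uv(1) add(1,2)
      by (subst T.M.finsum_insert) (auto intro!: tensor_closed[OF V W])
    moreover have "\<forall>i<Suc n. (u'(n := v)) i \<in> carrier V \<and> (v'(n := w)) i \<in> carrier W"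
      using uv(1) add(1,2) by (auto simp: less_Suc_eq)
    ultimately show ?case by blast
  qed
  then show thesis using that by blast
qed

lemma dual_space_simps:
  "carrier (dual_space R V) = module_hom R V (self_space R) \<inter> extensional (carrier V)"
  "zero (dual_space R V) = (\<lambda>v\<in>carrier V. \<zero>)"
  "add (dual_space R V) = (\<lambda>f g. \<lambda>v\<in>carrier V. f v \<oplus> g v)"
  "smult (dual_space R V) = (\<lambda>c f. \<lambda>v\<in>carrier V. c \<otimes> f v)"
  by (auto simp: dual_space_def func_space_def)

lemma dual_space_module:
  assumes V: "module R V"
  shows "module R (dual_space R V)"
proof -
  interpret V: module R V by (rule V)
  interpret F: module R "func_space (carrier V)" by (rule func_space_is_module)
  have "submodule R (module_hom R V (self_space R) \<inter> extensional (carrier V)) (func_space (carrier V))"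
    by (rule submodule.intro)
      (auto simp: func_space_is_module, auto simp: func_space_def module_hom_def self_space_simps
        PiE_iff Pi_iff r_distr a_ac m_ac)
  from F.submodule_is_module[OF this] show ?thesis
    by (simp add: dual_space_def)
qed

end

section \<open>Coalgebras spanned by incidence elements\<close>

lemma locally_finite_orderD: "\<lbrakk>locally_finite_order r; (x, y) \<in> r\<rbrakk> \<Longrightarrow> finite (interval r x y)"
  by (auto simp: locally_finite_order_def)

text \<open>
  All coalgebra axioms are equations between linear maps, so they can be checked on the family \<open>e\<close>;
  it only has to span, linear independence is irrelevant.
\<close>

lemma (in field) incidence_coalgebraI:
  fixes D :: "('a, 'd) module" and e :: "'x \<times> 'x \<Rightarrow> 'd"
  assumes D: "module R D" and e: "e \<in> r \<rightarrow> carrier D"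
    and span: "lin_ext R r D e ` carrier (free_space R r) = carrier D"
    and po: "partial_order_on X r" and lf: "locally_finite_order r"
    and \<Delta>: "\<Delta> \<in> module_hom R D (tensor_space R D D)"
    and \<epsilon>: "\<epsilon> \<in> module_hom R D (self_space R)"
    and \<Delta>_e: "\<And>x y. (x, y) \<in> r \<Longrightarrow>
      \<Delta> (e (x, y)) = (\<Oplus>\<^bsub>tensor_space R D D\<^esub> z\<in>interval r x y. tensor R D D (e (x, z)) (e (z, y)))"
    and \<epsilon>_e: "\<And>x y. (x, y) \<in> r \<Longrightarrow> \<epsilon> (e (x, y)) = (if x = y then \<one> else \<zero>)"
  shows "coalgebra R D \<Delta> \<epsilon>"
proof (rule coalgebra.intro)
  show "vectorspace R D"
    by (rule vectorspaceI[OF field_axioms D])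
  interpret D: module R D by (rule D)
  let ?DD = "tensor_space R D D"
  let ?D3 = "tensor_space R D ?DD"
  let ?D3' = "tensor_space R ?DD D"
  have DD: "module R ?DD" by (rule tensor_space_module[OF D D])
  have D3: "module R ?D3" by (rule tensor_space_module[OF D DD])
  have D3': "module R ?D3'" by (rule tensor_space_module[OF DD D])
  interpret D3: module R ?D3 by (rule D3)
  have tr: "(x, z) \<in> r" if "(x, y) \<in> r" "(y, z) \<in> r" for x y z
    using po that unfolding partial_order_on_def preorder_on_def by (meson transD)
  have rf: "(x, x) \<in> r" "(y, y) \<in> r" if "(x, y) \<in> r" for x y
    using po that unfolding partial_order_on_def preorder_on_def refl_on_def by auto
  have int_r: "(x, z) \<in> r" "(z, y) \<in> r" if "z \<in> interval r x y" for x y z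
    using that by (auto simp: interval_def)
  have int_rE: P if "z \<in> interval r x y" "\<lbrakk>(x, z) \<in> r; (z, y) \<in> r\<rbrakk> \<Longrightarrow> P" for x y z P
    using that by (auto simp: interval_def)
  have int_ends: "x \<in> interval r x y" "y \<in> interval r x y" if "(x, y) \<in> r" for x y
    using that rf[OF that] by (auto simp: interval_def)
  have e': "e p \<in> carrier D" if "p \<in> r" for p using e that by auto
  note fin = locally_finite_orderD[OF lf]
  note tc = tensor_closed[OF D D]
  note hom_ext = spanning_hom_eqI[OF D _ e span]
  note map1_hom = tensor_map_hom[OF D D DD D \<Delta> module_hom_id]
    and map1 = tensor_map_tensor[OF D D DD D \<Delta> module_hom_id]
    and map2_hom = tensor_map_hom[OF D D D DD module_hom_id \<Delta>]
    and map2 = tensor_map_tensor[OF D D D DD module_hom_id \<Delta>]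
    and assoc_hom = tensor_assoc_hom[OF D D D]
    and assoc = tensor_assoc_tensor[OF D D D]
  have \<epsilon>c: "\<epsilon> d \<in> carrier R" if "d \<in> carrier D" for d
    using module_hom_in_carrier[OF \<epsilon> that] by (simp add: self_space_simps)
  have bil: "bilinear_map D D D (\<lambda>a b. \<epsilon> a \<odot>\<^bsub>D\<^esub> b)" "bilinear_map D D D (\<lambda>a b. \<epsilon> b \<odot>\<^bsub>D\<^esub> a)"
    using module_hom_smult_right[OF D _ \<epsilon>] module_hom_scale[OF D module_hom_id] \<epsilon>c
    by (auto simp: bilinear_map_def)
  note l_hom = tensor_lift_hom[OF D D D bil(1)] and r_hom = tensor_lift_hom[OF D D D bil(2)]
  note l = tensor_lift_tensor[OF D D D bil(1)] and r = tensor_lift_tensor[OF D D D bil(2)]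
  show "coalgebra_axioms R D \<Delta> \<epsilon>"
  proof
    fix c assume c: "c \<in> carrier D"
    show "tensor_assoc R D D D (tensor_map R D D ?DD D \<Delta> (\<lambda>x. x) (\<Delta> c)) =
        tensor_map R D D D ?DD (\<lambda>x. x) \<Delta> (\<Delta> c)"
    proof (rule hom_ext[OF D3 _ _ _ c])
      show "(\<lambda>c. tensor_assoc R D D D (tensor_map R D D ?DD D \<Delta> (\<lambda>x. x) (\<Delta> c))) \<in> module_hom R D ?D3"
        by (intro module_hom_comp[OF assoc_hom] module_hom_comp[OF map1_hom] \<Delta>)
      show "(\<lambda>c. tensor_map R D D D ?DD (\<lambda>x. x) \<Delta> (\<Delta> c)) \<in> module_hom R D ?D3"
        by (intro module_hom_comp[OF map2_hom] \<Delta>)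
      fix p assume "p \<in> r"
      then obtain x y where xy: "p = (x, y)" "(x, y) \<in> r" by (cases p) auto
      let ?I = "interval r x y"
      let ?t = "\<lambda>w z. tensor R D ?DD (e (x, w)) (tensor R D D (e (w, z)) (e (z, y)))"
      have "tensor_assoc R D D D (tensor_map R D D ?DD D \<Delta> (\<lambda>x. x) (\<Delta> (e (x, y)))) =
          (\<Oplus>\<^bsub>?D3\<^esub> z\<in>?I. tensor_assoc R D D D (tensor_map R D D ?DD D \<Delta> (\<lambda>x. x)
            (tensor R D D (e (x, z)) (e (z, y)))))"
        unfolding \<Delta>_e[OF xy(2)]
        by (rule module_hom_finsum[OF DD D3 module_hom_comp[OF assoc_hom map1_hom]])
          (auto intro!: tc e' elim!: int_rE)
      \<comment> \<open>Applying \<Delta> to the left factor splits the interval from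
        \<open>x\<close> to \<open>z\<close> at a further point \<open>w\<close>; reassociating
        gives \<open>?t w z\<close>.\<close>
      also have "\<dots> = (\<Oplus>\<^bsub>?D3\<^esub> z\<in>?I. \<Oplus>\<^bsub>?D3\<^esub> w\<in>interval r x z. ?t w z)"
      proof (rule D3.M.finsum_cong')
        fix z assume z: "z \<in> ?I"
        note zr = int_r[OF z]
        have "tensor_assoc R D D D (tensor_map R D D ?DD D \<Delta> (\<lambda>x. x) (tensor R D D (e (x, z)) (e (z, y)))) =
            tensor_assoc R D D D (tensor R ?DD D (\<Oplus>\<^bsub>?DD\<^esub> w\<in>interval r x z. tensor R D D (e (x, w)) (e (w, z))) (e (z, y)))"
          using zr by (simp add: map1 e' \<Delta>_e)
        also have "\<dots> = (\<Oplus>\<^bsub>?D3\<^esub> w\<in>interval r x z.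
            tensor_assoc R D D D (tensor R ?DD D (tensor R D D (e (x, w)) (e (w, z))) (e (z, y))))"
          using zr
          by (intro module_hom_finsum[OF DD D3 module_hom_comp[OF assoc_hom tensor_hom_left[OF DD D]]])
            (auto intro!: tc e' elim!: int_rE)
        also have "\<dots> = (\<Oplus>\<^bsub>?D3\<^esub> w\<in>interval r x z. ?t w z)"
        proof (rule D3.M.finsum_cong')
          fix w assume "w \<in> interval r x z"
          from int_r[OF this] zr show "tensor_assoc R D D D
              (tensor R ?DD D (tensor R D D (e (x, w)) (e (w, z))) (e (z, y))) = ?t w z"
            by (simp add: assoc e')
        qed (use zr in \<open>auto intro!: tensor_closed[OF D DD] tc e' elim!: int_rE\<close>)
        finally show "tensor_assoc R D D D (tensor_map R D D ?DD D \<Delta> (\<lambda>x. x) (tensor R D D (e (x, z)) (e (z, y)))) =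
          (\<Oplus>\<^bsub>?D3\<^esub> w\<in>interval r x z. ?t w z)" .
      qed (auto intro!: D3.M.finsum_closed tensor_closed[OF D DD] tc e' elim!: int_rE)
      \<comment> \<open>Both double sums range over the chains x \<le> w \<le> z \<le> y;
        transitivity shows that the two descriptions of the range agree.\<close>
      also have "\<dots> = (\<Oplus>\<^bsub>?D3\<^esub> w\<in>?I. \<Oplus>\<^bsub>?D3\<^esub> z\<in>interval r w y. ?t w z)"
      proof (rule D3.M.finsum_swap_dependent)
        fix z w
        show "z \<in> ?I \<and> w \<in> interval r x z \<longleftrightarrow> w \<in> ?I \<and> z \<in> interval r w y"
          using tr unfolding interval_def by blast
      qed (auto intro!: fin xy tensor_closed[OF D DD] tc e' elim!: int_rE)
      also have "\<dots> = (\<Oplus>\<^bsub>?D3\<^esub> w\<in>?I. tensor_map R D D D ?DD (\<lambda>x. x) \<Delta> (tensor R D D (e (x, w)) (e (w, y))))"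
      proof (rule D3.M.finsum_cong')
        fix w assume w: "w \<in> ?I"
        note wr = int_r[OF w]
        show "(\<Oplus>\<^bsub>?D3\<^esub> z\<in>interval r w y. ?t w z) =
          tensor_map R D D D ?DD (\<lambda>x. x) \<Delta> (tensor R D D (e (x, w)) (e (w, y)))"
          using wr by (simp add: map2 e' \<Delta>_e)
            (intro module_hom_finsum[OF DD D3 tensor_hom_right[OF D DD], symmetric]; auto intro!: tc e' elim!: int_rE)
      qed (auto intro!: module_hom_in_carrier[OF map2_hom] tc e' elim!: int_rE)
      also have "\<dots> = tensor_map R D D D ?DD (\<lambda>x. x) \<Delta> (\<Delta> (e (x, y)))"
        unfolding \<Delta>_e[OF xy(2)]
        by (rule module_hom_finsum[OF DD D3 map2_hom, symmetric]) (auto intro!: tc e' elim!: int_rE)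
      finally show "tensor_assoc R D D D (tensor_map R D D ?DD D \<Delta> (\<lambda>x. x) (\<Delta> (e p))) =
        tensor_map R D D D ?DD (\<lambda>x. x) \<Delta> (\<Delta> (e p))"
        by (simp only: xy)
    qed
    show "tensor_lift R D D D (\<lambda>a b. \<epsilon> a \<odot>\<^bsub>D\<^esub> b) (\<Delta> c) = c"
    proof (rule hom_ext[OF D module_hom_comp[OF l_hom \<Delta>] module_hom_id _ c])
      fix p assume "p \<in> r"
      then obtain x y where xy: "p = (x, y)" "(x, y) \<in> r" by (cases p) auto
      have "tensor_lift R D D D (\<lambda>a b. \<epsilon> a \<odot>\<^bsub>D\<^esub> b) (\<Delta> (e (x, y))) =
          (\<Oplus>\<^bsub>D\<^esub> z\<in>interval r x y. tensor_lift R D D D (\<lambda>a b. \<epsilon> a \<odot>\<^bsub>D\<^esub> b) (tensor R D D (e (x, z)) (e (z, y))))"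
        unfolding \<Delta>_e[OF xy(2)]
        by (rule module_hom_finsum[OF DD D l_hom]) (auto intro!: tc e' elim!: int_rE)
      \<comment> \<open>The counit annihilates \<open>e (x, z)\<close> unless \<open>z = x\<close>;
        reflexivity puts \<open>x\<close> into the interval, so exactly one term is left.\<close>
      also have "\<dots> = (\<Oplus>\<^bsub>D\<^esub> z\<in>interval r x y. if x = z then e (z, y) else \<zero>\<^bsub>D\<^esub>)"
      proof (rule D.M.finsum_cong')
        fix z assume "z \<in> interval r x y"
        from int_r[OF this] show "tensor_lift R D D D (\<lambda>a b. \<epsilon> a \<odot>\<^bsub>D\<^esub> b) (tensor R D D (e (x, z)) (e (z, y))) =
            (if x = z then e (z, y) else \<zero>\<^bsub>D\<^esub>)"
          by (simp add: l e' \<epsilon>_e)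
      qed (auto intro!: e' elim!: int_rE)
      also have "\<dots> = e (x, y)"
        using int_ends[OF xy(2)] fin[OF xy(2)]
        by (intro D.M.finsum_singleton) (auto intro!: e' elim!: int_rE)
      finally show "tensor_lift R D D D (\<lambda>a b. \<epsilon> a \<odot>\<^bsub>D\<^esub> b) (\<Delta> (e p)) = e p"
        by (simp only: xy)
    qed
    show "tensor_lift R D D D (\<lambda>a b. \<epsilon> b \<odot>\<^bsub>D\<^esub> a) (\<Delta> c) = c"
    proof (rule hom_ext[OF D module_hom_comp[OF r_hom \<Delta>] module_hom_id _ c])
      fix p assume "p \<in> r"
      then obtain x y where xy: "p = (x, y)" "(x, y) \<in> r" by (cases p) auto
      have "tensor_lift R D D D (\<lambda>a b. \<epsilon> b \<odot>\<^bsub>D\<^esub> a) (\<Delta> (e (x, y))) =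
          (\<Oplus>\<^bsub>D\<^esub> z\<in>interval r x y. tensor_lift R D D D (\<lambda>a b. \<epsilon> b \<odot>\<^bsub>D\<^esub> a) (tensor R D D (e (x, z)) (e (z, y))))"
        unfolding \<Delta>_e[OF xy(2)]
        by (rule module_hom_finsum[OF DD D r_hom]) (auto intro!: tc e' elim!: int_rE)
      \<comment> \<open>Here the counit acts on the right factor, and the surviving index is
        \<open>z = y\<close>.\<close>
      also have "\<dots> = (\<Oplus>\<^bsub>D\<^esub> z\<in>interval r x y. if y = z then e (x, z) else \<zero>\<^bsub>D\<^esub>)"
      proof (rule D.M.finsum_cong')
        fix z assume "z \<in> interval r x y"
        from int_r[OF this] show "tensor_lift R D D D (\<lambda>a b. \<epsilon> b \<odot>\<^bsub>D\<^esub> a) (tensor R D D (e (x, z)) (e (z, y))) =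
            (if y = z then e (x, z) else \<zero>\<^bsub>D\<^esub>)"
          by (simp add: r e' \<epsilon>_e)
      qed (auto intro!: e' elim!: int_rE)
      also have "\<dots> = e (x, y)"
        using int_ends[OF xy(2)] fin[OF xy(2)]
        by (intro D.M.finsum_singleton) (auto intro!: e' elim!: int_rE)
      finally show "tensor_lift R D D D (\<lambda>a b. \<epsilon> b \<odot>\<^bsub>D\<^esub> a) (\<Delta> (e p)) = e p"
        by (simp only: xy)
    qed
  qed (fact \<Delta> \<epsilon>)+
qed

section \<open>Finitary incidence algebras and their finite duals\<close>

lemma self_space_minus: "a_minus (self_space R) = a_minus R"
  by (simp add: fun_eq_iff a_minus_def a_inv_def m_inv_def self_space_def)

text \<open>\<open>fin_inc_alg\<close> and \<open>free_space\<close> share all vector space fields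
  and differ only in \<open>mult\<close> and \<open>one\<close>, which the module axioms do not
  inspect.\<close>

lemma module_cong:
  fixes M N :: "('a, 'b, 'c) module_scheme"
  assumes M: "module R M"
    and eq: "carrier N = carrier M" "zero N = zero M" "add N = add M" "smult N = smult M"
  shows "module R N"
proof -
  interpret M: module R M by (rule M)
  have am: "add_monoid N = add_monoid M"
    by (simp add: eq)
  have "abelian_group N"
    using M.M.abelian_group_axioms
    by (simp add: abelian_group_def abelian_group_axioms_def abelian_monoid_def am)
  then show ?thesis
    by (rule moduleI[OF M.R.is_cring])
      (auto simp: eq M.smult_l_distr M.smult_r_distr M.smult_assoc1)
qed

context field
begin

lemma fin_inc_alg_simps:
  "carrier (fin_inc_alg R r) = carrier (free_space R r)"
  "zero (fin_inc_alg R r) = zero (free_space R r)"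
  "add (fin_inc_alg R r) = add (free_space R r)"
  "smult (fin_inc_alg R r) = smult (free_space R r)"
  "mult (fin_inc_alg R r) =
    (\<lambda>f g. \<lambda>(x, y)\<in>r. \<Oplus> z\<in>interval r x y. f (x, z) \<otimes> g (z, y))"
  by (auto simp: fin_inc_alg_def inc_alg_def free_space_def func_space_def)

lemma fin_inc_alg_module: "module R (fin_inc_alg R r)"
  by (rule module_cong[OF free_space_module]) (simp_all add: fin_inc_alg_simps)

lemma module_hom_fin_inc_alg: "module_hom R (fin_inc_alg R r) U = module_hom R (free_space R r) U"
  by (simp add: module_hom_def fin_inc_alg_simps)

lemma coordinate_hom:
  "s \<in> S \<Longrightarrow> (\<lambda>c. c s) \<in> module_hom R (free_space R S) (self_space R)"
  by (rule module_homI) (auto simp: free_space_simps self_space_simps)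

text \<open>Both sides are the symmetric pairing of two finitely supported functions, summed over
  the union of the supports. It lets \<open>theta\<close> be read as linear in the algebra element
  or as linear in the coalgebra element.\<close>

lemma lin_ext_self_space_commute:
  assumes c: "c \<in> carrier (free_space R S)" and d: "d \<in> carrier (free_space R S)"
  shows "lin_ext R S (self_space R) c d = lin_ext R S (self_space R) d c"
proof -
  let ?A = "{s \<in> S. c s \<noteq> \<zero>} \<union> {s \<in> S. d s \<noteq> \<zero>}"
  have fin: "finite ?A" "?A \<subseteq> S" using c d by (auto simp: free_space_simps)
  have cl: "c s \<in> carrier R" "d s \<in> carrier R" if "s \<in> S" for s
    using c d that by (auto simp: free_space_simps)
  have "lin_ext R S (self_space R) c d = (\<Oplus>\<^bsub>self_space R\<^esub> s\<in>?A. d s \<odot>\<^bsub>self_space R\<^esub> c s)"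
    using fin by (intro lin_ext_eq_finsum[OF self_space_module _ d]) (auto simp: self_space_simps cl)
  also have "\<dots> = (\<Oplus>\<^bsub>self_space R\<^esub> s\<in>?A. c s \<odot>\<^bsub>self_space R\<^esub> d s)"
    using cl unfolding self_space_simps by (intro finsum_cong') (auto simp: m_comm)
  also have "\<dots> = lin_ext R S (self_space R) d c"
    using fin by (intro lin_ext_eq_finsum[OF self_space_module _ c, symmetric]) (auto simp: self_space_simps cl)
  finally show ?thesis .
qed

context
  fixes X :: "'x set" and r :: "('x \<times> 'x) set"
  assumes po: "partial_order_on X r" and lf: "locally_finite_order r"
begin

section \<open>Product and matrix units of the finitary incidence algebra\<close>

abbreviation (input) "A \<equiv> fin_inc_alg R r"
abbreviation (input) "C \<equiv> inc_coalg R r"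

lemmas C_def = inc_coalg_def[of R r]

interpretation A: module R A by (rule fin_inc_alg_module)
interpretation C: module R C unfolding C_def by (rule free_space_module)

lemma order_trans: "\<lbrakk>(x, y) \<in> r; (y, z) \<in> r\<rbrakk> \<Longrightarrow> (x, z) \<in> r"
  using po unfolding partial_order_on_def preorder_on_def by (meson transD)

lemma order_refl: "(x, y) \<in> r \<Longrightarrow> (x, x) \<in> r" "(x, y) \<in> r \<Longrightarrow> (y, y) \<in> r"
  using po unfolding partial_order_on_def preorder_on_def refl_on_def by auto

lemma A_coeff_closed: "\<lbrakk>a \<in> carrier A; p \<in> r\<rbrakk> \<Longrightarrow> a p \<in> carrier R"
  by (auto simp: fin_inc_alg_simps free_space_simps)

lemma interval_in_order: "z \<in> interval r x y \<Longrightarrow> (x, z) \<in> r \<and> (z, y) \<in> r"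
  by (simp add: interval_def)

lemma interval_ends: "(x, y) \<in> r \<Longrightarrow> x \<in> interval r x y" "(x, y) \<in> r \<Longrightarrow> y \<in> interval r x y"
  using order_refl by (auto simp: interval_def)

lemma A_mult_eq:
  "(x, y) \<in> r \<Longrightarrow> (a \<otimes>\<^bsub>A\<^esub> b) (x, y) = (\<Oplus> z\<in>interval r x y. a (x, z) \<otimes> b (z, y))"
  by (simp add: fin_inc_alg_simps)

text \<open>A nonzero entry of the product at \<open>(x, y)\<close> needs some \<open>z\<close> with
  \<open>a (x, z)\<close> and \<open>b (z, y)\<close> both nonzero. So the support lies in the first
  components of the support of \<open>a\<close> times the second components of that of
  \<open>b\<close>, which is finite.\<close>

lemma A_mult_closed:
  assumes a: "a \<in> carrier A" and b: "b \<in> carrier A"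
  shows "a \<otimes>\<^bsub>A\<^esub> b \<in> carrier A"
proof -
  have cl: "(\<Oplus> z\<in>interval r x y. a (x, z) \<otimes> b (z, y)) \<in> carrier R" for x y
    using A_coeff_closed[OF a] A_coeff_closed[OF b] interval_in_order
    by (intro finsum_closed) blast
  let ?S = "fst ` {p \<in> r. a p \<noteq> \<zero>} \<times> snd ` {p \<in> r. b p \<noteq> \<zero>}"
  have "(x, y) \<in> ?S" if xy: "(x, y) \<in> r" "(a \<otimes>\<^bsub>A\<^esub> b) (x, y) \<noteq> \<zero>" for x y
  proof (rule ccontr)
    assume nS: "(x, y) \<notin> ?S"
    have "a (x, z) \<otimes> b (z, y) = \<zero>" if "z \<in> interval r x y" for z
    proof -
      have zr: "(x, z) \<in> r" "(z, y) \<in> r" using interval_in_order[OF that] by auto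
      then have "a (x, z) = \<zero> \<or> b (z, y) = \<zero>"
        using nS by force
      then show ?thesis
        using A_coeff_closed[OF a zr(1)] A_coeff_closed[OF b zr(2)] by auto
    qed
    then have "(\<Oplus> z\<in>interval r x y. a (x, z) \<otimes> b (z, y)) = \<zero>"
      by (rule add.finprod_one_eqI)
    then show False using xy A_mult_eq by simp
  qed
  then have "{p \<in> r. (a \<otimes>\<^bsub>A\<^esub> b) p \<noteq> \<zero>} \<subseteq> ?S" by auto
  moreover have "finite ?S" using a b by (auto simp: fin_inc_alg_simps free_space_simps)
  ultimately have "finite {p \<in> r. (a \<otimes>\<^bsub>A\<^esub> b) p \<noteq> \<zero>}" by (rule finite_subset)
  then show ?thesis
    using cl unfolding fin_inc_alg_simps(1) free_space_simps(1)
    by (auto simp: fin_inc_alg_simps(5))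
qed

lemma E_closed: "p \<in> r \<Longrightarrow> basis_vec R r p \<in> carrier A"
  unfolding fin_inc_alg_simps by (rule basis_vec_closed)

text \<open>In the convolution sum only the endpoint \<open>z = s\<close>, respectively
  \<open>z = t\<close>, can contribute; what is left is row \<open>x\<close>, respectively column
  \<open>x\<close>, of \<open>a\<close>.\<close>

lemma E_mult:
  assumes a: "a \<in> carrier A" and x: "(x, x) \<in> r"
  shows "basis_vec R r (x, x) \<otimes>\<^bsub>A\<^esub> a = (\<lambda>(s, t)\<in>r. if s = x then a (s, t) else \<zero>)"
    and "a \<otimes>\<^bsub>A\<^esub> basis_vec R r (x, x) = (\<lambda>(s, t)\<in>r. if t = x then a (s, t) else \<zero>)"
proof -
  have "(\<Oplus> z\<in>interval r s t. basis_vec R r (x, x) (s, z) \<otimes> a (z, t)) = (if s = x then a (s, t) else \<zero>)"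
    if st: "(s, t) \<in> r" for s t
  proof -
    have "(\<Oplus> z\<in>interval r s t. basis_vec R r (x, x) (s, z) \<otimes> a (z, t)) =
        (\<Oplus> z\<in>interval r s t. if s = z then (if s = x then a (z, t) else \<zero>) else \<zero>)"
    proof (rule finsum_cong')
      fix z assume "z \<in> interval r s t"
      then have "(s, z) \<in> r" "(z, t) \<in> r" using interval_in_order by auto
      then show "basis_vec R r (x, x) (s, z) \<otimes> a (z, t) =
          (if s = z then (if s = x then a (z, t) else \<zero>) else \<zero>)"
        using A_coeff_closed[OF a] by (auto simp: basis_vec_def)
    qed (use A_coeff_closed[OF a] interval_in_order in auto)
    also have "\<dots> = (if s = x then a (s, t) else \<zero>)"
    proof (rule finsum_singleton)
      show "(\<lambda>z. if s = x then a (z, t) else \<zero>) \<in> interval r s t \<rightarrow> carrier R"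
        using A_coeff_closed[OF a] interval_in_order by force
    qed (use interval_ends[OF st] locally_finite_orderD[OF lf st] in auto)
    finally show ?thesis .
  qed
  then show "basis_vec R r (x, x) \<otimes>\<^bsub>A\<^esub> a = (\<lambda>(s, t)\<in>r. if s = x then a (s, t) else \<zero>)"
    by (auto simp: fin_inc_alg_simps fun_eq_iff)
next
  have "(\<Oplus> z\<in>interval r s t. a (s, z) \<otimes> basis_vec R r (x, x) (z, t)) = (if t = x then a (s, t) else \<zero>)"
    if st: "(s, t) \<in> r" for s t
  proof -
    have "(\<Oplus> z\<in>interval r s t. a (s, z) \<otimes> basis_vec R r (x, x) (z, t)) =
        (\<Oplus> z\<in>interval r s t. if t = z then (if t = x then a (s, z) else \<zero>) else \<zero>)"
    proof (rule finsum_cong')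
      fix z assume "z \<in> interval r s t"
      then have "(s, z) \<in> r" "(z, t) \<in> r" using interval_in_order by auto
      then show "a (s, z) \<otimes> basis_vec R r (x, x) (z, t) =
          (if t = z then (if t = x then a (s, z) else \<zero>) else \<zero>)"
        using A_coeff_closed[OF a] by (auto simp: basis_vec_def)
    qed (use A_coeff_closed[OF a] interval_in_order in auto)
    also have "\<dots> = (if t = x then a (s, t) else \<zero>)"
    proof (rule finsum_singleton)
      show "(\<lambda>z. if t = x then a (s, z) else \<zero>) \<in> interval r s t \<rightarrow> carrier R"
        using A_coeff_closed[OF a] interval_in_order by force
    qed (use interval_ends[OF st] locally_finite_orderD[OF lf st] in auto)
    finally show ?thesis .
  qed
  then show "a \<otimes>\<^bsub>A\<^esub> basis_vec R r (x, x) = (\<lambda>(s, t)\<in>r. if t = x then a (s, t) else \<zero>)"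
    by (auto simp: fin_inc_alg_simps fun_eq_iff)
qed

section \<open>Two-sided ideals of finite codimension\<close>

lemma ideal_contains_E:
  assumes I: "two_sided_ideal R A I" and a: "a \<in> I" and p: "p \<in> r" and ap: "a p \<noteq> \<zero>"
  shows "basis_vec R r p \<in> I"
proof -
  obtain x y where xy: "p = (x, y)" "(x, y) \<in> r" using p by (cases p) auto
  interpret I: submodule R I A
    using I by (auto simp: two_sided_ideal_def subspace_def)
  have aA: "a \<in> carrier A" using a I.subset by auto
  let ?Ea = "basis_vec R r (x, x) \<otimes>\<^bsub>A\<^esub> a"
  have E: "basis_vec R r (x, x) \<in> carrier A" "basis_vec R r (y, y) \<in> carrier A"
    using E_closed order_refl[OF xy(2)] by auto
  have "?Ea \<in> I" "?Ea \<otimes>\<^bsub>A\<^esub> basis_vec R r (y, y) \<in> I"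
    using I a E by (auto simp: two_sided_ideal_def)
  moreover have "?Ea \<otimes>\<^bsub>A\<^esub> basis_vec R r (y, y) = a p \<odot>\<^bsub>A\<^esub> basis_vec R r p"
    unfolding E_mult(2)[OF A_mult_closed[OF E(1) aA] order_refl(2)[OF xy(2)]]
    unfolding E_mult(1)[OF aA order_refl(1)[OF xy(2)]]
    using xy A_coeff_closed[OF aA p]
    by (auto simp: fun_eq_iff fin_inc_alg_simps(4) free_space_simps(4) basis_vec_def)
  \<comment> \<open>The nonzero entry \<open>a p\<close> is invertible in the field, and
    \<open>I\<close> is closed under scalars, so the factor can be cancelled.\<close>
  ultimately have "inv (a p) \<odot>\<^bsub>A\<^esub> (a p \<odot>\<^bsub>A\<^esub> basis_vec R r p) \<in> I"
    using A_coeff_closed[OF aA p] ap by simp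
  moreover have "inv (a p) \<odot>\<^bsub>A\<^esub> (a p \<odot>\<^bsub>A\<^esub> basis_vec R r p) = basis_vec R r p"
    using A_coeff_closed[OF aA p] ap E_closed[OF p] field_Units
    by (simp flip: A.smult_assoc1)
  ultimately show ?thesis by simp
qed

lemma finite_E_not_in_ideal:
  assumes I: "two_sided_ideal R A I" and fd: "vectorspace.fin_dim R (quot_space A I)"
  shows "finite {p \<in> r. basis_vec R r p \<notin> I}"
proof -
  let ?S = "{p \<in> r. basis_vec R r p \<notin> I}"
  let ?q = "\<lambda>p. I +>\<^bsub>A\<^esub> basis_vec R r p"
  have sub: "submodule R I A"
    using I by (auto simp: two_sided_ideal_def subspace_def)
  interpret I: submodule R I A by (rule sub)
  interpret Q: vectorspace R "quot_space A I"
    by (rule vectorspaceI[OF field_axioms quot_space_module[OF sub]])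
  note q_hom = coset_hom[OF sub]
  \<comment> \<open>Linear independence bounds only the number of distinct cosets, so distinct
    matrix units must be shown to have distinct ones: otherwise their difference would lie in
    \<open>I\<close> with entry one at \<open>p\<close>, forcing the matrix unit of \<open>p\<close>
    into \<open>I\<close>.\<close>
  have inj: "inj_on ?q ?S"
  proof (rule inj_onI, rule ccontr)
    fix p p' assume p: "p \<in> ?S" "p' \<in> ?S" "?q p = ?q p'" "p \<noteq> p'"
    have "basis_vec R r p \<ominus>\<^bsub>A\<^esub> basis_vec R r p' \<in> I"
      using coset_eq_iff[OF sub] p E_closed by blast
    moreover have "(basis_vec R r p \<ominus>\<^bsub>A\<^esub> basis_vec R r p') p = \<one>"
      using module_hom_minus[OF A.module_axioms self_space_module, unfolded module_hom_fin_inc_alg, OF coordinate_hom]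
        p E_closed by (simp add: self_space_minus basis_vec_def a_minus_def)
    ultimately have "basis_vec R r p \<in> I"
      by (intro ideal_contains_E[OF I, of "basis_vec R r p \<ominus>\<^bsub>A\<^esub> basis_vec R r p'"]) (use p in auto)
    then show False using p by simp
  qed
  have "Q.lin_indpt (?q ` ?S)"
  proof
    assume "Q.lin_dep (?q ` ?S)"
    then obtain F a v where F: "finite F" "F \<subseteq> ?q ` ?S" "a \<in> F \<rightarrow> carrier R"
      "Q.lincomb a F = \<zero>\<^bsub>quot_space A I\<^esub>" "v \<in> F" "a v \<noteq> \<zero>"
      unfolding Q.lin_dep_def by blast
    obtain G where G: "G \<subseteq> ?S" "F = ?q ` G" using F(2) by (meson subset_imageE)
    have injG: "inj_on ?q G" using inj G(1) by (rule inj_on_subset)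
    then have finG: "finite G" using F(1) G(2) finite_imageD by blast
    obtain p where p: "p \<in> G" "v = ?q p" using F(5) G(2) by blast
    \<comment> \<open>The linear relation lifted to the algebra. Its coset is zero, so
      \<open>x\<close> lies in \<open>I\<close>; its entry at \<open>p\<close> is the nonzero
      coefficient \<open>a v\<close>, and \<open>ideal_contains_E\<close> then puts the matrix unit
      of \<open>p\<close> into \<open>I\<close>, a contradiction.\<close>
    define x where "x = (\<Oplus>\<^bsub>A\<^esub> s\<in>G. a (?q s) \<odot>\<^bsub>A\<^esub> basis_vec R r s)"
    have Gr: "s \<in> r" if "s \<in> G" for s using G that by auto
    have aq: "a (?q s) \<in> carrier R" if "s \<in> G" for s using F(3) G(2) that by auto
    have xA: "x \<in> carrier A"
      unfolding x_def by (intro A.M.finsum_closed) (auto intro!: A.smult_closed E_closed Gr aq)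
    have "I +>\<^bsub>A\<^esub> x = (\<Oplus>\<^bsub>quot_space A I\<^esub> s\<in>G. I +>\<^bsub>A\<^esub> (a (?q s) \<odot>\<^bsub>A\<^esub> basis_vec R r s))"
      unfolding x_def
      by (rule module_hom_finsum[OF A.module_axioms Q.module_axioms q_hom])
        (auto intro!: A.smult_closed E_closed Gr aq)
    also have "\<dots> = (\<Oplus>\<^bsub>quot_space A I\<^esub> s\<in>G. a (?q s) \<odot>\<^bsub>quot_space A I\<^esub> ?q s)"
      by (rule Q.M.finsum_cong')
        (auto intro!: Q.smult_closed module_hom_in_carrier[OF q_hom] module_hom_smult[OF q_hom] E_closed Gr aq)
    also have "\<dots> = Q.lincomb a F"
      unfolding Q.lincomb_def G(2) using injG
      by (intro Q.M.finsum_reindex[symmetric])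
        (auto intro!: Q.smult_closed module_hom_in_carrier[OF q_hom] E_closed Gr aq)
    also have "\<dots> = \<zero>\<^bsub>quot_space A I\<^esub>" by (rule F(4))
    finally have "x \<in> I" using coset_eq_zero_iff[OF sub xA] by simp
    moreover have "x p = a (?q p)"
    proof -
      have "x p = (\<Oplus>\<^bsub>self_space R\<^esub> s\<in>G. (a (?q s) \<odot>\<^bsub>A\<^esub> basis_vec R r s) p)"
        unfolding x_def
        by (rule module_hom_finsum[OF A.module_axioms self_space_module, unfolded module_hom_fin_inc_alg, OF coordinate_hom])
          (auto intro!: A.smult_closed E_closed Gr aq p)
      also have "\<dots> = (\<Oplus> s\<in>G. if p = s then a (?q s) else \<zero>)"
        unfolding self_space_simps using aq Gr p(1)
        by (intro finsum_cong') (auto simp: fin_inc_alg_simps(4) free_space_simps(4) basis_vec_def)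
      also have "\<dots> = a (?q p)"
        using p(1) finG aq by (intro finsum_singleton) auto
      finally show ?thesis .
    qed
    ultimately show False
      using ideal_contains_E[OF I, of x p] F(6) p G(1) by auto
  qed
  then have "finite (?q ` ?S)"
    by (rule Q.fin_dim_li_fin[OF fd]) (auto intro!: module_hom_in_carrier[OF q_hom] E_closed)
  then show ?thesis using inj by (rule finite_imageD)
qed


text \<open>Convexity makes this an ideal: for \<open>(x, y)\<close> in \<open>T\<close> every term
  \<open>a (x, z) \<otimes> b (z, y)\<close> has both positions in \<open>T\<close>, so one
  vanishing factor kills it. Matrix units outside \<open>T\<close> lie in \<open>I\<close>, hence
  the cosets of those inside \<open>T\<close> span the quotient.\<close>

lemma vanishing_ideal:
  assumes T: "finite T" "T \<subseteq> r"
    and convex: "\<And>x y z. \<lbrakk>(x, y) \<in> T; z \<in> interval r x y\<rbrakk> \<Longrightarrow> (x, z) \<in> T \<and> (z, y) \<in> T"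
  defines "I \<equiv> {a \<in> carrier A. \<forall>p\<in>T. a p = \<zero>}"
  shows "two_sided_ideal R A I" and "vectorspace.fin_dim R (quot_space A I)"
proof -
  have sub: "submodule R I A"
    unfolding I_def using T(2)
    by unfold_locales
      (auto simp: A.M.zero_closed, auto simp: fin_inc_alg_simps free_space_simps)
  have "a \<otimes>\<^bsub>A\<^esub> b \<in> I" if ab: "a \<in> carrier A" "b \<in> carrier A" "a \<in> I \<or> b \<in> I" for a b
  proof -
    have "(a \<otimes>\<^bsub>A\<^esub> b) (x, y) = \<zero>" if xy: "(x, y) \<in> T" for x y
    proof -
      have "a (x, z) \<otimes> b (z, y) = \<zero>" if z: "z \<in> interval r x y" for z
        using convex[OF xy z] ab A_coeff_closed[OF ab(1)] A_coeff_closed[OF ab(2)] interval_in_order[OF z]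
        by (auto simp: I_def)
      then have "(\<Oplus> z\<in>interval r x y. a (x, z) \<otimes> b (z, y)) = \<zero>"
        by (rule add.finprod_one_eqI)
      then show ?thesis using A_mult_eq xy T(2) by (simp add: subset_iff)
    qed
    then show ?thesis using A_mult_closed[OF ab(1,2)] by (auto simp: I_def)
  qed
  then show "two_sided_ideal R A I"
    unfolding two_sided_ideal_def subspace_def
    using sub vectorspaceI[OF field_axioms A.module_axioms] by (auto simp: I_def)
  interpret Q: vectorspace R "quot_space A I"
    by (rule vectorspaceI[OF field_axioms quot_space_module[OF sub]])
  let ?q = "\<lambda>a. I +>\<^bsub>A\<^esub> a"
  let ?B = "(\<lambda>p. ?q (basis_vec R r p)) ` T"
  have q_hom: "?q \<in> module_hom R (free_space R r) (quot_space A I)"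
    using coset_hom[OF sub] unfolding module_hom_fin_inc_alg .
  have B: "?B \<subseteq> carrier (quot_space A I)"
    using T(2) E_closed by (auto simp: quot_space_carrier)
  interpret S: submodule R "Q.span ?B" "quot_space A I"
    by (rule Q.span_is_submodule[OF B])
  have "?q (basis_vec R r p) \<in> Q.span ?B" if p: "p \<in> r" for p
  proof (cases "p \<in> T")
    case True
    then show ?thesis using Q.in_own_span[OF B] by blast
  next
    case False
    then have "basis_vec R r p \<in> I"
      using p E_closed T(2) by (auto simp: I_def basis_vec_def)
    then show ?thesis
      using coset_eq_zero_iff[OF sub E_closed[OF p]] S.zero_closed by simp
  qed
  then have "?q a \<in> Q.span ?B" if "a \<in> carrier A" for a
    using free_space_hom_range[OF q_hom S.submodule_axioms] that by (simp add: fin_inc_alg_simps)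
  then have "Q.span ?B = carrier (quot_space A I)"
    using Q.span_is_subset2[OF B] by (auto simp: quot_space_carrier)
  then show "vectorspace.fin_dim R (quot_space A I)"
    unfolding Q.fin_dim_def using B T(1) by blast
qed

section \<open>The map \<open>theta\<close> as a linear bijection onto the finite dual\<close>

abbreviation (input) "D \<equiv> finite_dual R A"

lemma C_simps: "carrier C = carrier (free_space R r)"
  by (simp add: inc_coalg_def)

lemma theta_apply:
  assumes c: "c \<in> carrier C" and a: "a \<in> carrier A"
  shows "theta R r c a = lin_ext R r (self_space R) c a"
    and "theta R r c a = lin_ext R r (self_space R) a c"
  using lin_ext_self_space_commute[of a r c] c a
  by (auto simp: theta_def inc_eval_def C_simps fin_inc_alg_simps)

lemma coeff_funcset: "c \<in> carrier C \<Longrightarrow> c \<in> r \<rightarrow> carrier (self_space R)"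
  "c \<in> carrier A \<Longrightarrow> c \<in> r \<rightarrow> carrier (self_space R)"
  by (auto simp: C_simps fin_inc_alg_simps free_space_simps self_space_simps)

lemma theta_E: "\<lbrakk>c \<in> carrier C; p \<in> r\<rbrakk> \<Longrightarrow> theta R r c (basis_vec R r p) = c p"
  by (simp add: theta_apply E_closed lin_ext_basis_vec[OF self_space_module] coeff_funcset)

lemma theta_basis_vec: "\<lbrakk>a \<in> carrier A; p \<in> r\<rbrakk> \<Longrightarrow> theta R r (basis_vec R r p) a = a p"
  by (simp add: theta_apply(2) C_simps basis_vec_closed lin_ext_basis_vec[OF self_space_module] coeff_funcset)

lemma theta_extensional: "theta R r c \<in> extensional (carrier A)"
  by (simp add: theta_def)

lemma theta_in_dual:
  assumes c: "c \<in> carrier C"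
  shows "theta R r c \<in> carrier (dual_space R A)"
proof -
  note h = lin_ext_hom[OF self_space_module coeff_funcset(1)[OF c], folded module_hom_fin_inc_alg]
  have "theta R r c \<in> module_hom R A (self_space R)"
    by (rule module_homI)
      (simp_all add: theta_apply(1)[OF c] module_hom_in_carrier[OF h] module_hom_add[OF h] module_hom_smult[OF h])
  then show ?thesis by (simp add: dual_space_simps theta_extensional)
qed

lemma theta_hom_dual: "theta R r \<in> module_hom R C (dual_space R A)"
proof (rule module_homI)
  have h: "(\<lambda>c. lin_ext R r (self_space R) a c) \<in> module_hom R C (self_space R)" if "a \<in> carrier A" for a
    unfolding C_def by (rule lin_ext_hom[OF self_space_module coeff_funcset(2)[OF that]])
  fix c d assume c: "c \<in> carrier C" "d \<in> carrier C"
  show "theta R r (c \<oplus>\<^bsub>C\<^esub> d) = theta R r c \<oplus>\<^bsub>dual_space R A\<^esub> theta R r d"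
    unfolding dual_space_simps using c
    by (intro extensionalityI[OF theta_extensional restrict_extensional])
      (simp add: theta_apply(2) module_hom_add[OF h] self_space_simps)
next
  have h: "(\<lambda>c. lin_ext R r (self_space R) a c) \<in> module_hom R C (self_space R)" if "a \<in> carrier A" for a
    unfolding C_def by (rule lin_ext_hom[OF self_space_module coeff_funcset(2)[OF that]])
  fix k c assume c: "k \<in> carrier R" "c \<in> carrier C"
  show "theta R r (k \<odot>\<^bsub>C\<^esub> c) = k \<odot>\<^bsub>dual_space R A\<^esub> theta R r c"
    unfolding dual_space_simps using c
    by (intro extensionalityI[OF theta_extensional restrict_extensional])
      (simp add: theta_apply(2) module_hom_smult[OF h] self_space_simps)
qed (rule theta_in_dual)

lemma theta_in_finite_dual:
  assumes c: "c \<in> carrier C"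
  shows "theta R r c \<in> carrier D"
proof -
  let ?S = "{p \<in> r. c p \<noteq> \<zero>}"
  \<comment> \<open>The support alone need not be closed under splitting an interval at an
    intermediate point, as \<open>vanishing_ideal\<close> requires; \<open>T\<close> adds all
    subintervals.\<close>
  define T where "T = {(u, v) \<in> r. \<exists>(x, y) \<in> ?S. (x, u) \<in> r \<and> (v, y) \<in> r}"
  \<comment> \<open>Local finiteness enters here: both endpoints of a subinterval lie in one of
    finitely many finite intervals.\<close>
  have "T \<subseteq> (\<Union>(x, y) \<in> ?S. interval r x y \<times> interval r x y)"
  proof
    fix q assume "q \<in> T"
    then obtain u v x y where q: "q = (u, v)" "(u, v) \<in> r" "(x, y) \<in> ?S" "(x, u) \<in> r" "(v, y) \<in> r"
      unfolding T_def by blast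
    then have "u \<in> interval r x y" "v \<in> interval r x y"
      using order_trans unfolding interval_def by blast+
    then show "q \<in> (\<Union>(x, y) \<in> ?S. interval r x y \<times> interval r x y)" using q by blast
  qed
  moreover have "finite (\<Union>(x, y) \<in> ?S. interval r x y \<times> interval r x y)"
    using c by (auto simp: C_simps free_space_simps locally_finite_orderD[OF lf])
  ultimately have T: "finite T" "T \<subseteq> r" by (auto intro: finite_subset simp: T_def)
  have ST: "?S \<subseteq> T" unfolding T_def using order_refl by blast
  have convex: "(u, z) \<in> T \<and> (z, v) \<in> T" if "(u, v) \<in> T" "z \<in> interval r u v" for u v z
    using that order_trans interval_in_order[OF that(2)] unfolding T_def by blast
  let ?I = "{a \<in> carrier A. \<forall>p\<in>T. a p = \<zero>}"
  have "theta R r c a = \<zero>" if a: "a \<in> ?I" for a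
  proof -
    have "lin_ext R r (self_space R) a c = (\<Oplus>\<^bsub>self_space R\<^esub> p\<in>T. c p \<odot>\<^bsub>self_space R\<^esub> a p)"
      using a c T ST by (intro lin_ext_eq_finsum[OF self_space_module coeff_funcset(2)]) (auto simp: C_simps)
    also have "\<dots> = \<zero>"
      unfolding self_space_simps using a coeff_funcset(1)[OF c] T(2)
      by (intro add.finprod_one_eqI) (auto simp: self_space_simps Pi_iff)
    finally show ?thesis using a c by (simp add: theta_apply(2))
  qed
  then have "?I \<subseteq> {a \<in> carrier A. theta R r c a = \<zero>}" by blast
  then show ?thesis
    using vanishing_ideal[OF T convex] theta_in_dual[OF c]
    unfolding finite_dual_def by auto
qed

lemma finite_dual_in_range:
  assumes f: "f \<in> carrier D"
  shows "\<exists>c\<in>carrier C. theta R r c = f"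
proof -
  obtain I where I: "two_sided_ideal R A I" "vectorspace.fin_dim R (quot_space A I)"
    "I \<subseteq> {a \<in> carrier A. f a = \<zero>}" and fd: "f \<in> carrier (dual_space R A)"
    using f by (auto simp: finite_dual_def)
  have hom: "f \<in> module_hom R (free_space R r) (self_space R)" and ext: "f \<in> extensional (carrier A)"
    using fd by (auto simp: dual_space_simps module_hom_fin_inc_alg)
  define c where "c = (\<lambda>p\<in>r. f (basis_vec R r p))"
  have "{p \<in> r. c p \<noteq> \<zero>} \<subseteq> {p \<in> r. basis_vec R r p \<notin> I}"
    using I(3) by (auto simp: c_def)
  then have "finite {p \<in> r. c p \<noteq> \<zero>}"
    using finite_E_not_in_ideal[OF I(1,2)] finite_subset by blast
  then have c: "c \<in> carrier C"
    using module_hom_in_carrier[OF hom basis_vec_closed]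
    by (auto simp: C_simps free_space_simps self_space_simps c_def)
  have th: "theta R r c \<in> module_hom R (free_space R r) (self_space R)"
    using theta_in_dual[OF c] by (auto simp: dual_space_simps module_hom_fin_inc_alg)
  have "theta R r c a = f a" if "a \<in> carrier A" for a
  proof (rule free_space_hom_eqI[OF self_space_module th hom])
    fix p assume "p \<in> r"
    then show "theta R r c (basis_vec R r p) = f (basis_vec R r p)"
      unfolding theta_E[OF c \<open>p \<in> r\<close>] by (simp add: c_def)
  qed (use that in \<open>simp add: fin_inc_alg_simps\<close>)
  then have "theta R r c = f"
    by (intro extensionalityI[OF theta_extensional ext])
  then show ?thesis using c by blast
qed

lemma theta_image: "theta R r ` carrier C = carrier D"
  using theta_in_finite_dual finite_dual_in_range by blast

text \<open>Evaluation at matrix units recovers every coordinate (\<open>theta_E\<close>), and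
  outside \<open>r\<close> both functions take the default value.\<close>

lemma theta_inj: "inj_on (theta R r) (carrier C)"
proof (rule inj_onI)
  fix c d assume cd: "c \<in> carrier C" "d \<in> carrier C" "theta R r c = theta R r d"
  have "c \<in> extensional r" "d \<in> extensional r"
    using cd(1,2) by (auto simp: C_simps free_space_simps PiE_iff)
  moreover have "c p = d p" if "p \<in> r" for p
    using theta_E that cd by metis
  ultimately show "c = d" by (rule extensionalityI)
qed

text \<open>As the image of a linear map into the full dual, \<open>D\<close> is a submodule of it;
  no ideal for a sum of two forms has to be exhibited.\<close>

lemma D_module: "module R D"
proof -
  interpret D0: module R "dual_space R A" by (rule dual_space_module[OF A.module_axioms])
  interpret th: mod_hom R C "dual_space R A" "theta R r"
    using theta_hom_dual by (simp add: mod_hom_def mod_hom_axioms_def C.module_axioms D0.module_axioms)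
  have "D = (dual_space R A)\<lparr>carrier := th.im\<rparr>"
    unfolding th.im_def theta_image by (simp add: finite_dual_def)
  then show ?thesis
    using D0.submodule_is_module[OF th.im_is_submodule] by simp
qed

lemma theta_hom: "theta R r \<in> module_hom R C D"
  using theta_hom_dual theta_in_finite_dual by (auto simp: module_hom_def finite_dual_def)

section \<open>Evaluation of tensors over the finite dual at pairs of algebra elements\<close>

abbreviation (input) "T \<equiv> tensor_space R D D"
abbreviation (input) "ev a b \<equiv> tensor_lift R D D (self_space R) (\<lambda>u v. u a \<otimes> v b)"

lemma C_module: "module R C"
  unfolding inc_coalg_def by (rule free_space_module)

lemma basis_vec_C: "p \<in> r \<Longrightarrow> basis_vec R r p \<in> carrier C"
  unfolding C_simps by (rule basis_vec_closed)

interpretation D: module R D by (rule D_module)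
interpretation T: module R T by (rule tensor_space_module[OF D_module D_module])
interpretation CC: module R "tensor_space R C C" by (rule tensor_space_module[OF C_module C_module])

lemma finite_dual_eval_hom:
  assumes "a \<in> carrier A"
  shows "(\<lambda>u. u a) \<in> module_hom R D (self_space R)"
  using assms
  by (intro module_homI)
    (auto simp: finite_dual_def dual_space_simps self_space_simps module_hom_def)

lemma finite_dual_eval_closed: "\<lbrakk>u \<in> carrier D; a \<in> carrier A\<rbrakk> \<Longrightarrow> u a \<in> carrier R"
  using module_hom_in_carrier[OF finite_dual_eval_hom] by (simp add: self_space_simps)

lemma ev_bilinear:
  assumes "a \<in> carrier A" "b \<in> carrier A"
  shows "bilinear_map D D (self_space R) (\<lambda>u v. u a \<otimes> v b)"
  unfolding bilinear_map_def
  using module_hom_scale[OF self_space_module finite_dual_eval_hom[OF assms(2)]]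
    module_hom_smult_right[OF self_space_module _ finite_dual_eval_hom[OF assms(1)]]
    finite_dual_eval_closed assms
  by (auto simp: self_space_simps)

lemmas ev_hom = tensor_lift_hom[OF D_module D_module self_space_module ev_bilinear]
  and ev_tensor = tensor_lift_tensor[OF D_module D_module self_space_module ev_bilinear]

text \<open>The linear extension is \<open>theta\<close> itself, by comparison on basis vectors, so
  its range is known from \<open>theta_image\<close>.\<close>

lemma theta_span:
  "lin_ext R r D (\<lambda>p. theta R r (basis_vec R r p)) ` carrier (free_space R r) = carrier D"
proof -
  have e: "(\<lambda>p. theta R r (basis_vec R r p)) \<in> r \<rightarrow> carrier D"
    using module_hom_in_carrier[OF theta_hom] basis_vec_C by blast
  have "lin_ext R r D (\<lambda>p. theta R r (basis_vec R r p)) c = theta R r c" if "c \<in> carrier (free_space R r)" for c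
    by (rule free_space_hom_eqI[OF D_module lin_ext_hom[OF D_module e] theta_hom[unfolded inc_coalg_def] _ that])
      (simp add: lin_ext_basis_vec[OF D_module e])
  then show ?thesis
    using theta_image by (simp add: C_simps)
qed

lemma ev_separates:
  assumes t: "t \<in> carrier T" "t' \<in> carrier T"
    and eq: "\<And>a b. \<lbrakk>a \<in> carrier A; b \<in> carrier A\<rbrakk> \<Longrightarrow> ev a b t = ev a b t'"
  shows "t = t'"
proof -
  let ?e = "\<lambda>p. theta R r (basis_vec R r p)"
  let ?g = "\<lambda>(p, q). tensor R D D (?e p) (?e q)"
  let ?L = "lin_ext R (r \<times> r) T ?g"
  have e: "?e p \<in> carrier D" if "p \<in> r" for p
    using module_hom_in_carrier[OF theta_hom] basis_vec_C that by blast
  have g: "?g \<in> r \<times> r \<rightarrow> carrier T"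
    by (auto intro!: tensor_closed[OF D_module D_module] e)
  have L: "?L ` carrier (free_space R (r \<times> r)) = carrier T"
    by (rule tensor_space_span[OF D_module D_module _ _ theta_span theta_span]) (auto simp: e)
  obtain c where c: "c \<in> carrier (free_space R (r \<times> r))" "t = ?L c" using t(1) L by blast
  obtain c' where c': "c' \<in> carrier (free_space R (r \<times> r))" "t' = ?L c'" using t(2) L by blast
  have coord: "ev (basis_vec R r p) (basis_vec R r q) (?L d) = d (p, q)"
    if "p \<in> r" "q \<in> r" "d \<in> carrier (free_space R (r \<times> r))" for p q d
  proof (rule free_space_hom_eqI[OF self_space_module _ coordinate_hom _ that(3)])
    show "(\<lambda>d. ev (basis_vec R r p) (basis_vec R r q) (?L d)) \<in>
        module_hom R (free_space R (r \<times> r)) (self_space R)"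
      by (rule module_hom_comp[OF ev_hom lin_ext_hom[OF T.module_axioms g]]) (simp_all add: E_closed that)
    fix s assume "s \<in> r \<times> r"
    then obtain p' q' where s: "s = (p', q')" "p' \<in> r" "q' \<in> r" by blast
    have "?L (basis_vec R (r \<times> r) s) = tensor R D D (?e p') (?e q')"
      using lin_ext_basis_vec[OF T.module_axioms g, of s] s by simp
    \<comment> \<open>By \<open>theta_E\<close> the value is a product of two Kronecker deltas, that
      is, the single delta on pairs.\<close>
    then have "ev (basis_vec R r p) (basis_vec R r q) (?L (basis_vec R (r \<times> r) s)) =
        basis_vec R r p' p \<otimes> basis_vec R r q' q"
      using s that by (simp add: ev_tensor E_closed e theta_E[OF basis_vec_C])
    then show "ev (basis_vec R r p) (basis_vec R r q) (?L (basis_vec R (r \<times> r) s)) =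
        basis_vec R (r \<times> r) s (p, q)"
      using s that by (auto simp: basis_vec_def)
  qed (use that in auto)
  have "c = c'"
  proof (rule extensionalityI[of _ "r \<times> r"])
    fix s assume "s \<in> r \<times> r"
    then obtain p q where pq: "s = (p, q)" "p \<in> r" "q \<in> r" by auto
    then show "c s = c' s"
      using coord[OF pq(2,3) c(1)] coord[OF pq(2,3) c'(1)] eq[OF E_closed E_closed, OF pq(2,3)] c(2) c'(2)
      by simp
  qed (use c(1) c'(1) in \<open>auto simp: free_space_simps PiE_iff\<close>)
  then show ?thesis using c c' by simp
qed

text \<open>This makes the definite description in \<^const>\<open>finite_dual_comult\<close> meaningful.\<close>

lemma finite_dual_comult_eqI:
  assumes t: "t \<in> carrier T"
    and ev: "\<And>a b. \<lbrakk>a \<in> carrier A; b \<in> carrier A\<rbrakk> \<Longrightarrow> ev a b t = f (a \<otimes>\<^bsub>A\<^esub> b)"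
  shows "finite_dual_comult R A f = t"
  unfolding finite_dual_comult_def Let_def
proof (rule the_equality)
  \<comment> \<open>Evaluated at \<open>(a, b)\<close>, a presentation turns into the sum of its
    defining condition. This serves existence, through a presentation of \<open>t\<close>, as well
    as uniqueness.\<close>
  have ev_sum: "ev a b (\<Oplus>\<^bsub>T\<^esub> i\<in>{..<n}. tensor R D D (u i) (v i)) = (\<Oplus> i\<in>{..<n}. u i a \<otimes> v i b)"
    if uv: "\<forall>i<n. u i \<in> carrier D \<and> v i \<in> carrier D" and ab: "a \<in> carrier A" "b \<in> carrier A"
    for n :: nat and u v a b
  proof -
    have "ev a b (\<Oplus>\<^bsub>T\<^esub> i\<in>{..<n}. tensor R D D (u i) (v i)) =
        (\<Oplus>\<^bsub>self_space R\<^esub> i\<in>{..<n}. ev a b (tensor R D D (u i) (v i)))"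
      using uv by (intro module_hom_finsum[OF T.module_axioms self_space_module ev_hom[OF ab]])
        (auto intro!: tensor_closed[OF D_module D_module])
    also have "\<dots> = (\<Oplus> i\<in>{..<n}. u i a \<otimes> v i b)"
      unfolding self_space_simps using uv ab
      by (intro finsum_cong') (auto simp: ev_tensor finite_dual_eval_closed)
    finally show ?thesis .
  qed
  show "\<exists>(n::nat) u v. (\<forall>i<n. u i \<in> carrier D \<and> v i \<in> carrier D) \<and>
      t = (\<Oplus>\<^bsub>T\<^esub> i\<in>{..<n}. tensor R D D (u i) (v i)) \<and>
      (\<forall>a\<in>carrier A. \<forall>b\<in>carrier A. f (a \<otimes>\<^bsub>A\<^esub> b) = (\<Oplus> i\<in>{..<n}. u i a \<otimes> v i b))"
  proof -
    obtain n :: nat and u v where uv: "\<forall>i<n. u i \<in> carrier D \<and> v i \<in> carrier D"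
      "t = (\<Oplus>\<^bsub>T\<^esub> i\<in>{..<n}. tensor R D D (u i) (v i))"
      using tensor_space_finsum[OF D_module D_module t] by blast
    have "f (a \<otimes>\<^bsub>A\<^esub> b) = (\<Oplus> i\<in>{..<n}. u i a \<otimes> v i b)" if "a \<in> carrier A" "b \<in> carrier A" for a b
      using ev[OF that] ev_sum[OF uv(1) that] uv(2) by simp
    with uv show ?thesis by blast
  qed
  fix t'
  assume "\<exists>(n::nat) u v. (\<forall>i<n. u i \<in> carrier D \<and> v i \<in> carrier D) \<and>
      t' = (\<Oplus>\<^bsub>T\<^esub> i\<in>{..<n}. tensor R D D (u i) (v i)) \<and>
      (\<forall>a\<in>carrier A. \<forall>b\<in>carrier A. f (a \<otimes>\<^bsub>A\<^esub> b) = (\<Oplus> i\<in>{..<n}. u i a \<otimes> v i b))"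
  then obtain n :: nat and u v where uv: "\<forall>i<n. u i \<in> carrier D \<and> v i \<in> carrier D"
    "t' = (\<Oplus>\<^bsub>T\<^esub> i\<in>{..<n}. tensor R D D (u i) (v i))"
    "\<forall>a\<in>carrier A. \<forall>b\<in>carrier A. f (a \<otimes>\<^bsub>A\<^esub> b) = (\<Oplus> i\<in>{..<n}. u i a \<otimes> v i b)" by blast
  have "t' \<in> carrier T"
    unfolding uv(2) using uv(1) by (intro T.M.finsum_closed) (auto intro!: tensor_closed[OF D_module D_module])
  \<comment> \<open>Any candidate has the values prescribed by \<open>f\<close> on products, just
    like \<open>t\<close>, and tensors are separated by their values.\<close>
  then show "t' = t"
    using t
  proof (rule ev_separates)
    fix a b assume "a \<in> carrier A" "b \<in> carrier A"
    then show "ev a b t' = ev a b t"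
      using ev_sum[OF uv(1)] uv(3) ev by (simp add: uv(2))
  qed
qed

section \<open>Comultiplication and counit transported along \<open>theta\<close>\<close>

abbreviation (input) "\<theta> \<equiv> theta R r"
abbreviation (input) "\<theta>\<theta> \<equiv> tensor_map R C C D D \<theta> \<theta>"

lemma inc_comult_funcset:
  "(\<lambda>(x, y). \<Oplus>\<^bsub>tensor_space R C C\<^esub> z\<in>interval r x y.
      tensor R C C (basis_vec R r (x, z)) (basis_vec R r (z, y))) \<in> r \<rightarrow> carrier (tensor_space R C C)"
  by (auto intro!: CC.M.finsum_closed tensor_closed[OF C_module C_module] basis_vec_C
      dest!: interval_in_order)

lemma inc_comult_hom: "inc_comult R r \<in> module_hom R C (tensor_space R C C)"
  unfolding inc_comult_def Let_def
  using lin_ext_hom[OF CC.module_axioms inc_comult_funcset] by (simp add: inc_coalg_def)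

lemma inc_comult_basis_vec:
  "(x, y) \<in> r \<Longrightarrow> inc_comult R r (basis_vec R r (x, y)) =
    (\<Oplus>\<^bsub>tensor_space R C C\<^esub> z\<in>interval r x y.
      tensor R C C (basis_vec R r (x, z)) (basis_vec R r (z, y)))"
  unfolding inc_comult_def Let_def
  using lin_ext_basis_vec[OF CC.module_axioms inc_comult_funcset, of "(x, y)"] by simp

lemma inc_counit_hom: "inc_counit R r \<in> module_hom R C (self_space R)"
  unfolding inc_counit_def inc_coalg_def
  by (rule lin_ext_hom[OF self_space_module]) (auto simp: self_space_simps)

lemma inc_counit_basis_vec:
  "(x, y) \<in> r \<Longrightarrow> inc_counit R r (basis_vec R r (x, y)) = (if x = y then \<one> else \<zero>)"
  unfolding inc_counit_def
  by (subst lin_ext_basis_vec[OF self_space_module]) (auto simp: self_space_simps)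

lemma inc_coalg_coalgebra: "coalgebra R C (inc_comult R r) (inc_counit R r)"
proof (rule incidence_coalgebraI[OF C_module])
  show "basis_vec R r \<in> r \<rightarrow> carrier C" using basis_vec_C by blast
  show "lin_ext R r C (basis_vec R r) ` carrier (free_space R r) = carrier C"
    unfolding inc_coalg_def by (simp add: lin_ext_self)
qed (fact po lf inc_comult_hom inc_counit_hom inc_comult_basis_vec inc_counit_basis_vec)+

lemmas theta_theta_hom = tensor_map_hom[OF C_module C_module D_module D_module theta_hom theta_hom]
  and theta_theta_tensor = tensor_map_tensor[OF C_module C_module D_module D_module theta_hom theta_hom]

lemma theta_theta_inc_comult_basis_vec:
  assumes "(x, y) \<in> r"
  shows "\<theta>\<theta> (inc_comult R r (basis_vec R r (x, y))) =
    (\<Oplus>\<^bsub>T\<^esub> z\<in>interval r x y. tensor R D D (\<theta> (basis_vec R r (x, z))) (\<theta> (basis_vec R r (z, y))))"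
proof -
  have "\<theta>\<theta> (inc_comult R r (basis_vec R r (x, y))) =
      (\<Oplus>\<^bsub>T\<^esub> z\<in>interval r x y. \<theta>\<theta> (tensor R C C (basis_vec R r (x, z)) (basis_vec R r (z, y))))"
    unfolding inc_comult_basis_vec[OF assms]
    by (rule module_hom_finsum[OF CC.module_axioms T.module_axioms theta_theta_hom])
      (auto intro!: tensor_closed[OF C_module C_module] basis_vec_C dest!: interval_in_order)
  also have "\<dots> = (\<Oplus>\<^bsub>T\<^esub> z\<in>interval r x y. tensor R D D (\<theta> (basis_vec R r (x, z))) (\<theta> (basis_vec R r (z, y))))"
  proof (rule T.M.finsum_cong')
    fix z assume "z \<in> interval r x y"
    from interval_in_order[OF this]
    show "\<theta>\<theta> (tensor R C C (basis_vec R r (x, z)) (basis_vec R r (z, y))) =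
        tensor R D D (\<theta> (basis_vec R r (x, z))) (\<theta> (basis_vec R r (z, y)))"
      by (simp add: theta_theta_tensor basis_vec_C)
  qed (auto intro!: tensor_closed[OF D_module D_module] module_hom_in_carrier[OF theta_hom] basis_vec_C
      dest!: interval_in_order)
  finally show ?thesis .
qed

lemma finite_dual_comult_theta:
  assumes c: "c \<in> carrier C"
  shows "finite_dual_comult R A (\<theta> c) = \<theta>\<theta> (inc_comult R r c)"
proof (rule finite_dual_comult_eqI)
  note tt_hom = module_hom_comp[OF theta_theta_hom inc_comult_hom]
  show "\<theta>\<theta> (inc_comult R r c) \<in> carrier T"
    by (rule module_hom_in_carrier[OF tt_hom c])
  fix a b assume ab: "a \<in> carrier A" "b \<in> carrier A"
  note ab' = A_mult_closed[OF ab]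
  show "ev a b (\<theta>\<theta> (inc_comult R r c)) = \<theta> c (a \<otimes>\<^bsub>A\<^esub> b)"
  proof (rule free_space_hom_eqI[OF self_space_module _ _ _ c[unfolded C_simps]])
    show "(\<lambda>c. ev a b (\<theta>\<theta> (inc_comult R r c))) \<in> module_hom R (free_space R r) (self_space R)"
      using module_hom_comp[OF ev_hom[OF ab] tt_hom] unfolding inc_coalg_def .
    show "(\<lambda>c. \<theta> c (a \<otimes>\<^bsub>A\<^esub> b)) \<in> module_hom R (free_space R r) (self_space R)"
      using module_hom_comp[OF finite_dual_eval_hom[OF ab'] theta_hom] unfolding inc_coalg_def .
    fix p assume "p \<in> r"
    then obtain x y where xy: "p = (x, y)" "(x, y) \<in> r" by (cases p) auto
    let ?t = "\<lambda>z. tensor R D D (\<theta> (basis_vec R r (x, z))) (\<theta> (basis_vec R r (z, y)))"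
    have "ev a b (\<theta>\<theta> (inc_comult R r (basis_vec R r p))) = (\<Oplus>\<^bsub>self_space R\<^esub> z\<in>interval r x y. ev a b (?t z))"
      unfolding xy(1) theta_theta_inc_comult_basis_vec[OF xy(2)]
      by (rule module_hom_finsum[OF T.module_axioms self_space_module ev_hom[OF ab]])
        (auto intro!: tensor_closed[OF D_module D_module] module_hom_in_carrier[OF theta_hom] basis_vec_C
          dest!: interval_in_order)
    also have "\<dots> = (\<Oplus> z\<in>interval r x y. a (x, z) \<otimes> b (z, y))"
      unfolding self_space_simps
    proof (rule finsum_cong')
      fix z assume "z \<in> interval r x y"
      from interval_in_order[OF this] show "ev a b (?t z) = a (x, z) \<otimes> b (z, y)"
        using ab by (simp add: ev_tensor module_hom_in_carrier[OF theta_hom] basis_vec_C theta_basis_vec)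
    qed (use A_coeff_closed interval_in_order ab in auto)
    also have "\<dots> = \<theta> (basis_vec R r p) (a \<otimes>\<^bsub>A\<^esub> b)"
      using xy ab' A_mult_eq[OF xy(2)] by (simp add: theta_basis_vec)
    finally show "ev a b (\<theta>\<theta> (inc_comult R r (basis_vec R r p))) = \<theta> (basis_vec R r p) (a \<otimes>\<^bsub>A\<^esub> b)" .
  qed
qed

lemma fin_inc_counit_theta:
  assumes c: "c \<in> carrier C"
  shows "fin_inc_counit R X r (\<theta> c) = inc_counit R r c"
proof -
  have diag: "(x, x) \<in> r \<longleftrightarrow> x \<in> X" for x
    using po by (auto simp: partial_order_on_def preorder_on_def refl_on_def)
  have cr: "c p \<in> carrier R" if "p \<in> r" for p
    using c that by (auto simp: C_simps free_space_simps)
  let ?S = "{p \<in> r. c p \<noteq> \<zero>}"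
  let ?d = "\<lambda>x. (x, x)"
  let ?Y = "{x \<in> X. c (x, x) \<noteq> \<zero>}"
  have "inc_counit R r c = (\<Oplus> p\<in>?S. c p \<otimes> (case p of (x, y) \<Rightarrow> if x = y then \<one> else \<zero>))"
    by (simp add: inc_counit_def lin_ext_def self_space_simps)
  \<comment> \<open>Off-diagonal terms carry the factor zero, and by reflexivity the diagonal of
    \<open>r\<close> is a copy of \<open>X\<close>.\<close>
  also have "\<dots> = (\<Oplus> p\<in>?d ` ?Y. c p)"
    using c cr diag
    by (intro add.finprod_mono_neutral_cong_right) (auto simp: C_simps free_space_simps)
  also have "\<dots> = (\<Oplus> x\<in>?Y. c (x, x))"
    using cr diag by (intro add.finprod_reindex) (auto simp: inj_on_def)
  also have "\<dots> = fin_inc_counit R X r (\<theta> c)"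
    unfolding fin_inc_counit_def using cr diag
    by (intro finsum_cong') (auto simp: theta_E[OF c])
  finally show ?thesis ..
qed

text \<open>Neither the definite description of the comultiplication nor a sum over an
  argument-dependent index set is visibly linear. Surjectivity and linearity of \<open>theta\<close>
  reduce linearity on \<open>D\<close> to linearity of the composite on \<open>C\<close>.\<close>

lemma hom_through_theta:
  assumes U: "module R U" and k: "k \<in> module_hom R C U" and eq: "\<And>c. c \<in> carrier C \<Longrightarrow> h (\<theta> c) = k c"
  shows "h \<in> module_hom R D U"
proof (rule module_homI)
  fix u assume "u \<in> carrier D"
  then obtain c where c: "c \<in> carrier C" "u = \<theta> c" using theta_image by blast
  then show "h u \<in> carrier U" using eq module_hom_in_carrier[OF k] by simp
  fix v assume "v \<in> carrier D"
  then obtain d where d: "d \<in> carrier C" "v = \<theta> d" using theta_image by blast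
  show "h (u \<oplus>\<^bsub>D\<^esub> v) = h u \<oplus>\<^bsub>U\<^esub> h v"
    using c d by (simp add: eq module_hom_add[OF k] flip: module_hom_add[OF theta_hom])
next
  fix a u assume a: "a \<in> carrier R" and "u \<in> carrier D"
  then obtain c where c: "c \<in> carrier C" "u = \<theta> c" using theta_image by blast
  show "h (a \<odot>\<^bsub>D\<^esub> u) = a \<odot>\<^bsub>U\<^esub> h u"
    using c a by (simp add: eq module_hom_smult[OF k] flip: module_hom_smult[OF theta_hom])
qed

lemma finite_dual_coalgebra:
  "coalgebra R D (finite_dual_comult R A) (fin_inc_counit R X r)"
\<comment> \<open>The spanning family is the image of the standard basis, whose comultiplication is
  known by transport through \<open>theta\<close>.\<close>
proof (rule incidence_coalgebraI[OF D_module _ theta_span po lf])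
  show "(\<lambda>p. \<theta> (basis_vec R r p)) \<in> r \<rightarrow> carrier D"
    using module_hom_in_carrier[OF theta_hom] basis_vec_C by blast
  show "finite_dual_comult R A \<in> module_hom R D T"
    by (rule hom_through_theta[OF T.module_axioms module_hom_comp[OF theta_theta_hom inc_comult_hom]
          finite_dual_comult_theta])
  show "fin_inc_counit R X r \<in> module_hom R D (self_space R)"
    by (rule hom_through_theta[OF self_space_module inc_counit_hom fin_inc_counit_theta])
  fix x y assume xy: "(x, y) \<in> r"
  show "finite_dual_comult R A (\<theta> (basis_vec R r (x, y))) =
    (\<Oplus>\<^bsub>T\<^esub> z\<in>interval r x y. tensor R D D (\<theta> (basis_vec R r (x, z))) (\<theta> (basis_vec R r (z, y))))"
    using xy by (simp add: finite_dual_comult_theta basis_vec_C theta_theta_inc_comult_basis_vec)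
  show "fin_inc_counit R X r (\<theta> (basis_vec R r (x, y))) = (if x = y then \<one> else \<zero>)"
    using xy by (simp add: fin_inc_counit_theta basis_vec_C inc_counit_basis_vec)
qed

lemma theta_coalgebra_iso:
  "coalgebra_iso R C (inc_comult R r) (inc_counit R r)
    D (finite_dual_comult R A) (fin_inc_counit R X r) \<theta>"
  by (intro coalgebra_iso.intro coalgebra_iso_axioms.intro inc_coalg_coalgebra finite_dual_coalgebra
      theta_hom finite_dual_comult_theta fin_inc_counit_theta)
    (simp add: bij_betw_def theta_inj theta_image)

end

end

theorem theorem4p2:
  fixes K :: "('k, 'm) ring_scheme" and X :: "'x set" and r :: "('x \<times> 'x) set"
  assumes "field K"
    and "partial_order_on X r"
    and "locally_finite_order r"
  shows "coalgebra_iso K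
           (inc_coalg K r) (inc_comult K r) (inc_counit K r)
           (finite_dual K (fin_inc_alg K r))
           (finite_dual_comult K (fin_inc_alg K r))
           (fin_inc_counit K X r)
           (theta K r)"
  using assms by (rule field.theta_coalgebra_iso)

end
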